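(* Let $\lambda=(n-m,m)$ with $0\le m\le\lfloor n/2\rfloor$, and let $q\in\mathbb{C}$ with $|q|=1$, $q$ not a root of unity. For a suitable choice of the nonzero real normalization of the invariant Hermitian form on $S^\lambda=S^\lambda(q^2)$, $$s_z(S^\lambda)=\sum_{\substack{1\le j_1<\cdots<j_m\le n\\ j_i\ge 2i\ \text{for all } i}}\ \prod_{i=1}^m a_{j_i-(2i-1)}\,a_{j_i-2(i-1)}\quad\text{in }\mathbb{Z}[z]/(z^2-1).$$
   Context: For $Q\in\mathbb{C}$, $|Q|=1$, $Q$ not a root of unity, $\mathcal{H}_n(Q)$ is the $\mathbb{C}$-algebra with generators $T_1,\dots,T_{n-1}$ and relations $T_iT_j=T_jT_i$ for $|i-j|>1$, $T_iT_{i+1}T_i=T_{i+1}T_iT_{i+1}$, $(T_i+1)(T_i-Q)=0$. $S^\lambda(Q)$ is the irreducible (Specht) module indexed by $\lambda$, with $(n)$ corresponding to $T_i\mapsto Q$; it carries a nondegenerate Hermitian form for which each $T_i$ is unitary, unique up to a nonzero real scalar. The refined signature is $s_z(S^\lambda)=p+rz\in\mathbb{Z}[z]/(z^2-1)$, where $p$ (resp. $r$) is the number of vectors of positive (resp. negative) norm in an orthogonal basis of $S^\lambda(q^2)$. (Setting $z=-1$ gives the signature, $z=1$ the dimension.) For nonzero integers $i$, $[[i]]_q=\frac{q^i-q^{-i}}{q-q^{-1}}\in\mathbb{R}$, and $a_i=a_i(q)\in\mathbb{Z}[z]/(z^2-1)$ equals $1$ if $[[i]]_q>0$ and $z$ if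 $[[i]]_q<0$. *)

theory Defs
  imports Complex_Main "HOL-Computational_Algebra.Polynomial" "HOL-Library.FuncSet"
    "HOL-Library.Function_Algebras" "HOL-Combinatorics.Permutations"
begin

section \<open>Complex vector spaces of functions\<close>

definition cscale :: "complex \<Rightarrow> ('b \<Rightarrow> complex) \<Rightarrow> ('b \<Rightarrow> complex)" where
  "cscale c f = (\<lambda>x. c * f x)"

global_interpretation cvs: vector_space "cscale :: complex \<Rightarrow> ('b \<Rightarrow> complex) \<Rightarrow> ('b \<Rightarrow> complex)"
  by unfold_locales (simp_all add: cscale_def fun_eq_iff algebra_simps)


section \<open>Modules over the Hecke algebra\<close>

text \<open>A (left) module over the algebra with generators \<open>T\<^sub>1, \<dots>, T\<^bsub>n-1\<^esub>\<close> and the Hecke relations is a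
  complex vector space with linear operators \<open>T\<^sub>1, \<dots>, T\<^bsub>n-1\<^esub>\<close> that satisfy these relations.\<close>

definition hecke_module ::
  "nat \<Rightarrow> complex \<Rightarrow> ('b \<Rightarrow> complex) set \<Rightarrow> (nat \<Rightarrow> ('b \<Rightarrow> complex) \<Rightarrow> ('b \<Rightarrow> complex)) \<Rightarrow> bool" where
  "hecke_module n Q V T \<longleftrightarrow>
     cvs.subspace V \<and>
     (\<forall>i\<in>{1..<n}. \<forall>v\<in>V. T i v \<in> V) \<and>
     (\<forall>i\<in>{1..<n}. \<forall>u\<in>V. \<forall>v\<in>V. T i (u + v) = T i u + T i v) \<and>
     (\<forall>i\<in>{1..<n}. \<forall>c. \<forall>v\<in>V. T i (cscale c v) = cscale c (T i v)) \<and>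
     (\<forall>i\<in>{1..<n}. \<forall>j\<in>{1..<n}. \<bar>int i - int j\<bar> > 1 \<longrightarrow>
        (\<forall>v\<in>V. T i (T j v) = T j (T i v))) \<and>
     (\<forall>i. i \<in> {1..<n} \<and> Suc i \<in> {1..<n} \<longrightarrow>
        (\<forall>v\<in>V. T i (T (Suc i) (T i v)) = T (Suc i) (T i (T (Suc i) v)))) \<and>
     (\<forall>i\<in>{1..<n}. \<forall>v\<in>V.
        (let w = T i v - cscale Q v in T i w + w) = 0)"


section \<open>Permutation modules and Specht modules\<close>

text \<open>A row-tabloid with entries \<open>1, \<dots>, n\<close> is encoded by the function that maps each entry to the
  number of its row (rows are counted from 1), and every other number to 0. An element of the
  permutation module \<open>M\<^sup>\<lambda>\<close> is encoded by its coefficients with respect to the basis of tabloids.\<close>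

type_synonym tabloid = "nat \<Rightarrow> nat"
type_synonym tabvec = "tabloid \<Rightarrow> complex"

definition tabloid_basis :: "tabloid \<Rightarrow> tabvec" where
  "tabloid_basis t = (\<lambda>w. if w = t then 1 else 0)"

text \<open>The Dipper--James action of \<open>T\<^sub>i\<close>, written in coordinates; the lemma \<open>hecke_T_basis\<close> below gives
  the usual description by the images of basis vectors.\<close>

definition hecke_T :: "complex \<Rightarrow> nat \<Rightarrow> tabvec \<Rightarrow> tabvec" where
  "hecke_T Q i f = (\<lambda>w.
     let w' = w \<circ> transpose i (Suc i) in
     if w i = w (Suc i) then Q * f w
     else if w i < w (Suc i) then Q * f w'
     else f w' + (Q - 1) * f w)"

lemma hecke_T_basis:
  "hecke_T Q i (tabloid_basis t) =
     (if t i = t (Suc i) then cscale Q (tabloid_basis t)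
      else if t i < t (Suc i) then tabloid_basis (t \<circ> transpose i (Suc i))
      else cscale Q (tabloid_basis (t \<circ> transpose i (Suc i))) + cscale (Q - 1) (tabloid_basis t))"
proof
  fix w
  let ?s = "transpose i (Suc i)"
  have inv: "w \<circ> ?s = t \<longleftrightarrow> w = t \<circ> ?s"
    by (metis comp_assoc comp_id transpose_comp_involutory)
  have neq: "t \<noteq> t \<circ> ?s" if "t i \<noteq> t (Suc i)"
    using that by (metis comp_apply transpose_apply_first)
  consider "w = t" | "w \<noteq> t" "w = t \<circ> ?s" | "w \<noteq> t" "w \<noteq> t \<circ> ?s" by blast
  then show "hecke_T Q i (tabloid_basis t) w =
     (if t i = t (Suc i) then cscale Q (tabloid_basis t)
      else if t i < t (Suc i) then tabloid_basis (t \<circ> ?s)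
      else cscale Q (tabloid_basis (t \<circ> ?s)) + cscale (Q - 1) (tabloid_basis t)) w"
  proof cases
    case 1
    then show ?thesis
      using neq by (simp add: hecke_T_def tabloid_basis_def cscale_def Let_def inv[unfolded 1])
  next
    case 2
    have "t i \<noteq> t (Suc i)"
    proof
      assume "t i = t (Suc i)"
      then have "t \<circ> ?s = t" by (auto simp: fun_eq_iff transpose_def)
      with 2 show False by simp
    qed
    with 2 show ?thesis
      by (simp add: hecke_T_def tabloid_basis_def cscale_def Let_def inv comp_assoc)
  next
    case 3
    then show ?thesis
      by (simp add: hecke_T_def tabloid_basis_def cscale_def Let_def inv)
  qed
qed

text \<open>A partition is a nonempty weakly decreasing list of parts; trailing zeros are harmless.\<close>

definition conj_part :: "nat list \<Rightarrow> nat \<Rightarrow> nat" where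
  "conj_part la c = length (filter (\<lambda>p. c \<le> p) la)"

definition column_boxes :: "nat list \<Rightarrow> (nat \<times> nat) list" where
  "column_boxes la =
     concat (map (\<lambda>c. map (\<lambda>r. (r, c)) [1..<Suc (conj_part la c)]) [1..<Suc (hd la)])"

text \<open>The row and the column of the entry \<open>k\<close> in the tableau of shape \<open>\<lambda>\<close> in which the entries
  \<open>1, \<dots>, n\<close> are filled in down the columns, from the first column to the last.\<close>

definition column_tableau_row :: "nat list \<Rightarrow> nat \<Rightarrow> nat" where
  "column_tableau_row la k =
     (if k \<in> {1..sum_list la} then fst (column_boxes la ! (k - 1)) else 0)"

definition column_tableau_col :: "nat list \<Rightarrow> nat \<Rightarrow> nat" where
  "column_tableau_col la k =
     (if k \<in> {1..sum_list la} then snd (column_boxes la ! (k - 1)) else 0)"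

definition column_stabilizer :: "nat list \<Rightarrow> (nat \<Rightarrow> nat) set" where
  "column_stabilizer la =
     {\<sigma>. \<sigma> permutes {1..sum_list la} \<and>
         (\<forall>k\<in>{1..sum_list la}. column_tableau_col la (\<sigma> k) = column_tableau_col la k)}"

definition perm_length :: "nat \<Rightarrow> (nat \<Rightarrow> nat) \<Rightarrow> nat" where
  "perm_length n \<sigma> = card {(i, j). 1 \<le> i \<and> i < j \<and> j \<le> n \<and> \<sigma> j < \<sigma> i}"

text \<open>The Dipper--James generator \<open>y\<^bsub>\<lambda>'\<^esub> T\<^bsub>w\<^sub>\<lambda>\<^esub> x\<^sub>\<lambda>\<close> of the Specht module, where
  \<open>y\<^bsub>\<lambda>'\<^esub> = \<Sum>\<^sub>\<sigma> (-Q)\<^bsup>-\<ell>(\<sigma>)\<^esup> T\<^sub>\<sigma>\<close> runs over the column stabilizer of the column tableau. Its rows increase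
  from top to bottom within each column, hence \<open>T\<^sub>\<sigma>\<close> just permutes the entries of its tabloid. The
  tabloid of \<open>\<sigma>\<close> applied to the tableau is the row function composed with the inverse of \<open>\<sigma>\<close>.\<close>

definition specht_generator :: "complex \<Rightarrow> nat list \<Rightarrow> tabvec" where
  "specht_generator Q la =
     (\<Sum>\<sigma>\<in>column_stabilizer la.
        cscale (inverse (- Q) ^ perm_length (sum_list la) \<sigma>)
          (tabloid_basis (column_tableau_row la \<circ> inv \<sigma>)))"

text \<open>The submodule of the permutation module generated by this element; for \<open>Q\<close> not a root of unity it
  is the irreducible module indexed by \<open>\<lambda>\<close>. For the one-row partition \<open>(n)\<close> every \<open>T\<^sub>i\<close> acts as \<open>Q\<close>.\<close>

definition specht :: "complex \<Rightarrow> nat list \<Rightarrow> tabvec set" where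
  "specht Q la =
     \<Inter> {U. cvs.subspace U \<and> specht_generator Q la \<in> U \<and>
          (\<forall>i\<in>{1..<sum_list la}. \<forall>u\<in>U. hecke_T Q i u \<in> U)}"

lemma hecke_T_add: "hecke_T Q i (f + g) = hecke_T Q i f + hecke_T Q i g"
  by (auto simp: hecke_T_def Let_def fun_eq_iff algebra_simps)

lemma hecke_T_scale: "hecke_T Q i (cscale c f) = cscale c (hecke_T Q i f)"
  by (auto simp: hecke_T_def Let_def fun_eq_iff cscale_def algebra_simps)

lemma hecke_T_quadratic:
  "(let w = hecke_T Q i f - cscale Q f in hecke_T Q i w + w) = 0"
  by (auto simp: hecke_T_def Let_def fun_eq_iff cscale_def algebra_simps comp_assoc)

lemma transpose_commute_far:
  assumes "\<bar>int i - int j\<bar> > 1"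
  shows "transpose i (Suc i) \<circ> transpose j (Suc j) = transpose j (Suc j) \<circ> transpose i (Suc i)"
  using assms by (auto simp: fun_eq_iff transpose_def)

lemma hecke_T_commute:
  assumes "\<bar>int i - int j\<bar> > 1"
  shows "hecke_T Q i (hecke_T Q j f) = hecke_T Q j (hecke_T Q i f)"
proof -
  have fixed: "transpose i (Suc i) j = j" "transpose i (Suc i) (Suc j) = Suc j"
    "transpose j (Suc j) i = i" "transpose j (Suc j) (Suc i) = Suc i"
    using assms by (auto simp: transpose_def)
  show ?thesis
  proof
    fix w :: tabloid
    have comm: "w \<circ> transpose j (Suc j) \<circ> transpose i (Suc i) =
        w \<circ> transpose i (Suc i) \<circ> transpose j (Suc j)"
      by (simp add: comp_assoc transpose_commute_far[OF assms])
    show "hecke_T Q i (hecke_T Q j f) w = hecke_T Q j (hecke_T Q i f) w"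
      unfolding hecke_T_def Let_def comp_apply fixed transpose_apply_first transpose_apply_second comm
      by (simp add: algebra_simps)
  qed
qed

lemma hecke_T_eq: "w i = w (Suc i) \<Longrightarrow> hecke_T Q i f w = Q * f w"
  and hecke_T_less: "w i < w (Suc i) \<Longrightarrow> hecke_T Q i f w = Q * f (w \<circ> transpose i (Suc i))"
  and hecke_T_greater: "w (Suc i) < w i \<Longrightarrow>
    hecke_T Q i f w = f (w \<circ> transpose i (Suc i)) + (Q - 1) * f w"
  by (simp_all add: hecke_T_def Let_def)

lemma hecke_T_braid:
  "hecke_T Q i (hecke_T Q (Suc i) (hecke_T Q i f)) =
   hecke_T Q (Suc i) (hecke_T Q i (hecke_T Q (Suc i) f))"
proof
  fix w :: tabloid
  define s t where "s = transpose i (Suc i)" and "t = transpose (Suc i) (Suc (Suc i))"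
  have vals: "s i = Suc i" "s (Suc i) = i" "s (Suc (Suc i)) = Suc (Suc i)"
    "t i = i" "t (Suc i) = Suc (Suc i)" "t (Suc (Suc i)) = Suc i"
    by (auto simp: s_def t_def transpose_def)
  have ss: "w \<circ> s \<circ> s = w" "w \<circ> t \<circ> t = w" "w \<circ> s \<circ> t \<circ> t = w \<circ> s" "w \<circ> t \<circ> s \<circ> s = w \<circ> t"
    by (simp_all add: comp_assoc s_def t_def)
  have braid: "w \<circ> s \<circ> t \<circ> s = w \<circ> t \<circ> s \<circ> t"
    by (auto simp: fun_eq_iff s_def t_def transpose_def)
  note T = hecke_T_eq hecke_T_less[of _ i, folded s_def] hecke_T_less[of _ "Suc i", folded t_def]
    hecke_T_greater[of _ i, folded s_def] hecke_T_greater[of _ "Suc i", folded t_def]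
  show "hecke_T Q i (hecke_T Q (Suc i) (hecke_T Q i f)) w =
        hecke_T Q (Suc i) (hecke_T Q i (hecke_T Q (Suc i) f)) w"
    by (cases "w i" "w (Suc i)" rule: linorder_cases;
        cases "w (Suc i)" "w (Suc (Suc i))" rule: linorder_cases;
        cases "w i" "w (Suc (Suc i))" rule: linorder_cases)
      (linarith | (simp only: T vals ss braid comp_apply, (simp add: algebra_simps)?))+
qed

lemma hecke_module_specht: "hecke_module (sum_list la) Q (specht Q la) (hecke_T Q)"
proof -
  have "cvs.subspace (specht Q la)"
    unfolding specht_def by (rule cvs.subspace_Inter) blast
  moreover have "hecke_T Q i v \<in> specht Q la"
    if "i \<in> {1..<sum_list la}" "v \<in> specht Q la" for i v
    using that by (auto simp: specht_def)
  ultimately show ?thesis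
    unfolding hecke_module_def
    by (intro conjI ballI allI impI)
      (assumption | rule hecke_T_add hecke_T_scale hecke_T_commute hecke_T_braid hecke_T_quadratic
        | blast)+
qed


section \<open>Invariant Hermitian forms and the refined signature\<close>

definition hermitian_form_on ::
  "('b \<Rightarrow> complex) set \<Rightarrow> (('b \<Rightarrow> complex) \<Rightarrow> ('b \<Rightarrow> complex) \<Rightarrow> complex) \<Rightarrow> bool" where
  "hermitian_form_on V B \<longleftrightarrow>
     (\<forall>u\<in>V. \<forall>v\<in>V. \<forall>w\<in>V. B (u + v) w = B u w + B v w) \<and>
     (\<forall>c. \<forall>u\<in>V. \<forall>v\<in>V. B (cscale c u) v = c * B u v) \<and>
     (\<forall>u\<in>V. \<forall>v\<in>V. B v u = cnj (B u v))"

definition nondegenerate_on ::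
  "('b \<Rightarrow> complex) set \<Rightarrow> (('b \<Rightarrow> complex) \<Rightarrow> ('b \<Rightarrow> complex) \<Rightarrow> complex) \<Rightarrow> bool" where
  "nondegenerate_on V B \<longleftrightarrow> (\<forall>u\<in>V. (\<forall>v\<in>V. B u v = 0) \<longrightarrow> u = 0)"

definition invariant_form ::
  "nat \<Rightarrow> ('b \<Rightarrow> complex) set \<Rightarrow> (nat \<Rightarrow> ('b \<Rightarrow> complex) \<Rightarrow> ('b \<Rightarrow> complex)) \<Rightarrow>
   (('b \<Rightarrow> complex) \<Rightarrow> ('b \<Rightarrow> complex) \<Rightarrow> complex) \<Rightarrow> bool" where
  "invariant_form n V T B \<longleftrightarrow>
     hermitian_form_on V B \<and> nondegenerate_on V B \<and>
     (\<forall>i\<in>{1..<n}. \<forall>u\<in>V. \<forall>v\<in>V. B (T i u) (T i v) = B u v)"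

definition orthogonal_basis ::
  "('b \<Rightarrow> complex) set \<Rightarrow> (('b \<Rightarrow> complex) \<Rightarrow> ('b \<Rightarrow> complex) \<Rightarrow> complex) \<Rightarrow>
   ('b \<Rightarrow> complex) set \<Rightarrow> bool" where
  "orthogonal_basis V B b \<longleftrightarrow>
     finite b \<and> cvs.independent b \<and> cvs.span b = V \<and>
     (\<forall>u\<in>b. \<forall>v\<in>b. u \<noteq> v \<longrightarrow> B u v = 0)"

text \<open>The ring \<open>\<int>[z]/(z\<^sup>2 - 1)\<close>.\<close>

quotient_type sigring = "int poly" / "\<lambda>p q. [:-1, 0, 1:] dvd p - q"
proof (rule equivpI)
  show "reflp (\<lambda>p q. [:-1, 0, 1:] dvd p - (q :: int poly))"
    by (rule reflpI) simp
  show "symp (\<lambda>p q. [:-1, 0, 1:] dvd p - (q :: int poly))"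
    by (rule sympI) (metis dvd_minus_iff minus_diff_eq)
  show "transp (\<lambda>p q. [:-1, 0, 1:] dvd p - (q :: int poly))"
  proof (rule transpI)
    fix p q r :: "int poly"
    assume "[:-1, 0, 1:] dvd p - q" "[:-1, 0, 1:] dvd q - r"
    then have "[:-1, 0, 1:] dvd (p - q) + (q - r)" by (rule dvd_add)
    then show "[:-1, 0, 1:] dvd p - r" by simp
  qed
qed

instantiation sigring :: comm_ring_1
begin

lift_definition zero_sigring :: sigring is 0 .
lift_definition one_sigring :: sigring is 1 .
lift_definition plus_sigring :: "sigring \<Rightarrow> sigring \<Rightarrow> sigring" is "(+)"
  by (metis add_diff_add dvd_add)
lift_definition minus_sigring :: "sigring \<Rightarrow> sigring \<Rightarrow> sigring" is "(-)"
proof -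
  fix p q r s :: "int poly"
  assume "[:-1, 0, 1:] dvd p - q" "[:-1, 0, 1:] dvd r - s"
  then have "[:-1, 0, 1:] dvd (p - q) - (r - s)" by (rule dvd_diff)
  then show "[:-1, 0, 1:] dvd (p - r) - (q - s)" by (simp add: algebra_simps)
qed
lift_definition uminus_sigring :: "sigring \<Rightarrow> sigring" is uminus
  by (metis minus_diff_minus dvd_minus_iff)
lift_definition times_sigring :: "sigring \<Rightarrow> sigring \<Rightarrow> sigring" is "(*)"
proof -
  fix p q r s :: "int poly"
  assume "[:-1, 0, 1:] dvd p - q" "[:-1, 0, 1:] dvd r - s"
  then have "[:-1, 0, 1:] dvd (p - q) * r + q * (r - s)"
    by (rule dvd_add[OF dvd_mult2 dvd_mult])
  also have "(p - q) * r + q * (r - s) = p * r - q * s" by (simp add: algebra_simps)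
  finally show "[:-1, 0, 1:] dvd p * r - q * s" .
qed

instance
proof
  have "\<not> [:-1, 0, 1:] dvd (1 :: int poly)"
    using dvd_imp_degree_le[of "[:-1, 0, 1:]" "1 :: int poly"] by auto
  then show "(0 :: sigring) \<noteq> 1"
    by transfer (simp only: diff_0 dvd_minus_iff not_False_eq_True)
qed (transfer, simp add: algebra_simps)+

end

lift_definition zz :: sigring is "[:0, 1:]" .

lemma zz_times_zz: "zz * zz = 1"
  by transfer (simp add: one_pCons)

text \<open>By Sylvester's law of inertia the result does not depend on the chosen orthogonal basis.\<close>

definition refined_signature ::
  "('b \<Rightarrow> complex) set \<Rightarrow> (('b \<Rightarrow> complex) \<Rightarrow> ('b \<Rightarrow> complex) \<Rightarrow> complex) \<Rightarrow> sigring" where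
  "refined_signature V B =
     (let b = (SOME b. orthogonal_basis V B b) in
        of_nat (card {v \<in> b. Re (B v v) > 0}) + of_nat (card {v \<in> b. Re (B v v) < 0}) * zz)"


section \<open>Signs of quantum integers\<close>

definition quantum_int :: "complex \<Rightarrow> int \<Rightarrow> complex" where
  "quantum_int q i = (q powi i - q powi (- i)) / (q - inverse q)"

lemma quantum_int_real:
  assumes "cmod q = 1"
  shows "quantum_int q i \<in> \<real>"
proof -
  have "q * cnj q = 1"
    using assms by (simp add: complex_norm_square[symmetric])
  then have cnj_q: "cnj q = inverse q"
    by (metis inverse_unique)
  have "cnj (quantum_int q i) = (q powi (- i) - q powi i) / (inverse q - q)"
    by (simp add: quantum_int_def cnj_q power_int_minus power_int_inverse)
  also have "\<dots> = quantum_int q i"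
    unfolding quantum_int_def by (metis minus_diff_eq minus_divide_divide)
  finally show ?thesis by (simp add: Reals_cnj_iff)
qed

text \<open>Only used for \<open>i \<noteq> 0\<close> and \<open>q\<close> on the unit circle and not a root of unity; then the quantum integer is
  a nonzero real number.\<close>

definition qsign :: "complex \<Rightarrow> int \<Rightarrow> sigring" where
  "qsign q i = (if Re (quantum_int q i) > 0 then 1 else zz)"

end

theory Submission
  imports Defs
begin

text \<open>
  Put \<open>Q = q\<^sup>2\<close>. Tabloids with two rows are words in \<open>1, 2\<close>, so that the permutation module is a weight space of
  the \<open>n\<close>-th tensor power of \<open>\<complex>\<^sup>2\<close>, and the Specht module of \<open>(n-m, m)\<close> consists of the highest weight vectors
  in it for an action of the quantum group of \<open>sl\<^sub>2\<close> that commutes with all \<open>T\<^sub>i\<close>. Adding one tensor factor at a time,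
  and splitting the product with the irreducible module of highest weight \<open>h\<close> into those of highest weights
  \<open>h + 1\<close> and \<open>h - 1\<close>, gives a basis of vectors \<open>x\<^sub>D\<close> indexed by the ballot paths with \<open>m\<close> down steps, where \<open>D\<close> is the set of
  positions of the down steps. These vectors are defined by a recursion with explicit coefficients
  (\<open>seminormal\<close>), and the quantum group itself is not needed.

  On this basis \<open>T\<^sub>i\<close> acts by the scalar \<open>Q\<close> if the steps \<open>i\<close> and \<open>i + 1\<close> have the same direction and by \<open>-1\<close> if they go
  up and down from height 0; if they have different directions and start from a height \<open>d > 0\<close>, then \<open>T\<^sub>i\<close> acts by a
  matrix with two rows on the span of \<open>x\<^sub>D\<close> and the vector of the path in which the steps are exchanged (\<open>hecke_T_seminormal\<close>).
  Give \<open>x\<^sub>D\<close> the norm \<open>\<Prod> [[d]] [[d+1]]\<close>, where the product is over the down steps and \<open>d\<close> is the height from which the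
  step goes down. Exchanging an up step and a down step changes the norm by the ratio of \<open>[[d+2]]\<close> and \<open>[[d]]\<close>,
  and with the identity \<open>[[d+1]]\<^sup>2 = 1 + [[d]] [[d+2]]\<close> the blocks of all \<open>T\<^sub>i\<close> are unitary (\<open>block_unitary\<close>). This gives the
  existence of the invariant form.

  Conversely, let an invariant form be given. The Jucys--Murphy elements are products of generators, hence
  unitary; they act on \<open>x\<^sub>D\<close> by powers of \<open>Q\<close> that separate the paths, so that the \<open>x\<^sub>D\<close> are orthogonal
  (\<open>invariant_orthogonal\<close>). Invariance within a block determines the ratio of the two norms, and all paths arise from the
  zigzag path with down steps \<open>2, 4, \<dots>, 2m\<close>, whose vector is a multiple of the generator of the Specht module, by
  exchanging steps. Therefore the form is a real multiple of the one above (\<open>invariant_norms\<close>). By Sylvester's law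
  the refined signature is the sum over all paths of the sign of the norm. The \<open>i\<close>-th down step, if it is the step
  \<open>j\<^sub>i\<close>, starts from height \<open>d = j\<^sub>i - (2i - 1)\<close>, which gives the product in the formula.
\<close>

section \<open>Ballot paths and seminormal vectors\<close>

text \<open>The unnormalised quantum integer \<open>1 + Q + \<dots> + Q\<^bsup>k-1\<^esup>\<close>.\<close>
definition qnum :: "complex \<Rightarrow> nat \<Rightarrow> complex" where
  "qnum Q k = (\<Sum>i<k. Q ^ i)"

lemma qnum_0 [simp]: "qnum Q 0 = 0"
  by (simp add: qnum_def)

lemma qnum_Suc: "qnum Q (Suc k) = 1 + Q * qnum Q k"
  unfolding qnum_def by (subst sum.lessThan_Suc_shift) (simp add: sum_distrib_left)

lemma qnum_Suc': "qnum Q (Suc k) = qnum Q k + Q ^ k"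
  by (simp add: qnum_def)

text \<open>Tensoring with a basis vector of \<open>\<complex>\<^sup>2\<close>: if \<open>f\<close> is supported on tabloids without the entry \<open>p\<close>, then \<open>p\<close> is put
  into row \<open>a\<close> of each of them.\<close>
definition append_entry :: "nat \<Rightarrow> nat \<Rightarrow> tabvec \<Rightarrow> tabvec" where
  "append_entry p a f = (\<lambda>w. if w p = a then f (w(p := 0)) else 0)"

text \<open>A set \<open>D\<close> of positive integers encodes the lattice path whose step \<open>p\<close> goes down if \<open>p \<in> D\<close> and up otherwise;
  down steps correspond to entries of the second row. The height after \<open>n\<close> steps is truncated at 0, which
  has no effect on ballot paths.\<close>
primrec height :: "nat set \<Rightarrow> nat \<Rightarrow> nat" where
  "height D 0 = 0"
| "height D (Suc n) = (if Suc n \<in> D then height D n - 1 else height D n + 1)"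

text \<open>The number of down steps among the first \<open>n\<close> steps.\<close>
primrec downs :: "nat set \<Rightarrow> nat \<Rightarrow> nat" where
  "downs D 0 = 0"
| "downs D (Suc n) = (if Suc n \<in> D then downs D n + 1 else downs D n)"

text \<open>The first \<open>n\<close> steps of the path stay at nonnegative height.\<close>
primrec ballot :: "nat set \<Rightarrow> nat \<Rightarrow> bool" where
  "ballot D 0 = True"
| "ballot D (Suc n) = (ballot D n \<and> (Suc n \<in> D \<longrightarrow> 0 < height D n))"

text \<open>If \<open>Q\<close> is not a root of unity, then the \<open>n\<close>-th tensor power of \<open>\<complex>\<^sup>2\<close> is a sum of irreducible modules for the
  quantum group of \<open>sl\<^sub>2\<close>, one of dimension \<open>h + 1\<close> for each ballot path of length \<open>n\<close> and final height \<open>h\<close>. Here \<open>seminormal Q D n k\<close> is the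
  highest weight vector of the module of the ballot path \<open>D\<close>, lowered \<open>k\<close> times; the coefficients are the quantum
  Clebsch--Gordan coefficients of the product of this module with \<open>\<complex>\<^sup>2\<close>. Only \<open>k = 0\<close> enters the Specht module,
  but the recursion needs all \<open>k\<close>. The sign \<open>(-1)\<^sup>h\<close> is chosen such that for two paths that differ by exchanging
  an up step and a following down step the sum of the two vectors lies in the image of \<open>Q - T\<^sub>i\<close>.
  For \<open>k = 0\<close> the term with \<open>k - 1\<close> has coefficient 0.\<close>
primrec seminormal :: "complex \<Rightarrow> nat set \<Rightarrow> nat \<Rightarrow> nat \<Rightarrow> tabvec" where
  "seminormal Q D 0 k = (if k = 0 then tabloid_basis (\<lambda>_. 0) else 0)"
| "seminormal Q D (Suc n) k =
    (if Suc n \<in> D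
     then cscale ((-1) ^ height D n) (append_entry (Suc n) 1 (seminormal Q D n (Suc k)) +
            cscale (- (Q ^ Suc (downs D n) * (qnum Q (height D n) - qnum Q k)))
              (append_entry (Suc n) 2 (seminormal Q D n k)))
     else append_entry (Suc n) 1 (seminormal Q D n k) +
            cscale (Q ^ downs D n * qnum Q k) (append_entry (Suc n) 2 (seminormal Q D n (k - 1))))"

lemma append_entry_zero [simp]: "append_entry p a 0 = 0"
  by (simp add: append_entry_def fun_eq_iff)

lemma append_entry_add: "append_entry p a (f + g) = append_entry p a f + append_entry p a g"
  by (simp add: append_entry_def fun_eq_iff)

lemma append_entry_diff: "append_entry p a (f - g) = append_entry p a f - append_entry p a g"
  by (simp add: append_entry_def fun_eq_iff)

lemma append_entry_minus: "append_entry p a (- f) = - append_entry p a f"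
  by (simp add: append_entry_def fun_eq_iff)

lemma hecke_T_diff: "hecke_T Q i (f - g) = hecke_T Q i f - hecke_T Q i g"
  by (auto simp: hecke_T_def Let_def fun_eq_iff algebra_simps)

lemma hecke_T_minus: "hecke_T Q i (- f) = - hecke_T Q i f"
  by (auto simp: hecke_T_def Let_def fun_eq_iff algebra_simps)

lemma append_entry_scale: "append_entry p a (cscale c f) = cscale c (append_entry p a f)"
  by (simp add: append_entry_def cscale_def fun_eq_iff)

lemma append_entry_sum: "append_entry p a (sum f A) = (\<Sum>D\<in>A. append_entry p a (f D))"
  by (induction A rule: infinite_finite_induct) (simp_all only: sum.infinite sum.empty sum.insert
        append_entry_zero append_entry_add not_False_eq_True)

lemma hecke_T_append:
  assumes "Suc i < p"
  shows "hecke_T Q i (append_entry p a f) = append_entry p a (hecke_T Q i f)"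
proof
  fix w :: tabloid
  have "(w \<circ> transpose i (Suc i))(p := 0) = w(p := 0) \<circ> transpose i (Suc i)"
    using assms by (auto simp: fun_eq_iff transpose_def)
  moreover have "(w \<circ> transpose i (Suc i)) p = w p"
    using assms by (simp add: transpose_def)
  ultimately show "hecke_T Q i (append_entry p a f) w = append_entry p a (hecke_T Q i f) w"
    using assms by (simp add: hecke_T_def append_entry_def Let_def)
qed

text \<open>The action of \<open>T\<^sub>i\<close> on the last two tensor factors, which are the entries \<open>i\<close> and \<open>i + 1\<close>.\<close>
lemma hecke_T_append_two:
  fixes i :: nat
  defines "E \<equiv> \<lambda>a b f. append_entry (Suc i) b (append_entry i a f)"
  shows "hecke_T Q i (E a a f) = cscale Q (E a a f)"
    and "a < b \<Longrightarrow> hecke_T Q i (E a b f) = E b a f"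
    and "b < a \<Longrightarrow> hecke_T Q i (E a b f) = cscale Q (E b a f) + cscale (Q - 1) (E a b f)"
proof -
  have tw: "(w \<circ> transpose i (Suc i)) (Suc i := 0, i := 0) = w(Suc i := 0, i := 0)" for w :: tabloid
    by (auto simp: fun_eq_iff transpose_def)
  have t: "(w \<circ> transpose i (Suc i)) (Suc i) = w i" "(w \<circ> transpose i (Suc i)) i = w (Suc i)"
    for w :: tabloid by simp_all
  have E: "E a b f = (\<lambda>w. if w i = a \<and> w (Suc i) = b then f (w(Suc i := 0, i := 0)) else 0)" for a b f
    by (auto simp: E_def append_entry_def)
  show "hecke_T Q i (E a a f) = cscale Q (E a a f)"
    unfolding E hecke_T_def Let_def t tw cscale_def by auto
  show "a < b \<Longrightarrow> hecke_T Q i (E a b f) = E b a f"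
    unfolding E hecke_T_def Let_def t tw cscale_def by (auto simp: fun_eq_iff hecke_T_def)
  show "b < a \<Longrightarrow> hecke_T Q i (E a b f) = cscale Q (E b a f) + cscale (Q - 1) (E a b f)"
    unfolding E hecke_T_def Let_def t tw cscale_def by (auto simp: fun_eq_iff)
qed

lemma height_cong: "D \<inter> {1..n} = D' \<inter> {1..n} \<Longrightarrow> height D n = height D' n"
  and downs_cong: "D \<inter> {1..n} = D' \<inter> {1..n} \<Longrightarrow> downs D n = downs D' n"
  and ballot_cong: "D \<inter> {1..n} = D' \<inter> {1..n} \<Longrightarrow> ballot D n = ballot D' n"
  and seminormal_cong: "D \<inter> {1..n} = D' \<inter> {1..n} \<Longrightarrow> seminormal Q D n k = seminormal Q D' n k"
proof -
  have *: "D \<inter> {1..n} = D' \<inter> {1..n} \<longrightarrow> height D n = height D' n \<and> downs D n = downs D' n \<and>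
     ballot D n = ballot D' n \<and> (\<forall>k. seminormal Q D n k = seminormal Q D' n k)"
  proof (induction n)
    case (Suc n)
    show ?case
    proof
      assume eq: "D \<inter> {1..Suc n} = D' \<inter> {1..Suc n}"
      have "Suc n \<in> D \<longleftrightarrow> Suc n \<in> D'"
        using eq by (metis IntD1 IntI atLeastAtMost_iff le_refl Suc_le_mono One_nat_def le0)
      moreover have "D \<inter> {1..n} = D' \<inter> {1..n}"
        using eq by (auto simp: atLeastAtMostSuc_conv set_eq_iff)
      ultimately show "height D (Suc n) = height D' (Suc n) \<and> downs D (Suc n) = downs D' (Suc n) \<and>
         ballot D (Suc n) = ballot D' (Suc n) \<and> (\<forall>k. seminormal Q D (Suc n) k = seminormal Q D' (Suc n) k)"
        using Suc.IH by simp
    qed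
  qed simp
  then show "D \<inter> {1..n} = D' \<inter> {1..n} \<Longrightarrow> height D n = height D' n"
    "D \<inter> {1..n} = D' \<inter> {1..n} \<Longrightarrow> downs D n = downs D' n"
    "D \<inter> {1..n} = D' \<inter> {1..n} \<Longrightarrow> ballot D n = ballot D' n"
    "D \<inter> {1..n} = D' \<inter> {1..n} \<Longrightarrow> seminormal Q D n k = seminormal Q D' n k" by blast+
qed

lemma height_downs: "ballot D n \<Longrightarrow> height D n + 2 * downs D n = n"
  by (induction n) (auto split: if_splits)

lemma downs_card: "downs D n = card (D \<inter> {1..n})"
proof (induction n)
  case (Suc n)
  have "D \<inter> {1..Suc n} = (if Suc n \<in> D then insert (Suc n) (D \<inter> {1..n}) else D \<inter> {1..n})"
    by (auto simp: atLeastAtMostSuc_conv)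
  then show ?case using Suc by simp
qed simp

lemma ballot_mono: "ballot D n \<Longrightarrow> k \<le> n \<Longrightarrow> ballot D k"
  by (induction n) (auto simp: le_Suc_eq)

text \<open>A module of highest weight \<open>h\<close> has no more than \<open>h + 1\<close> weight vectors.\<close>
lemma seminormal_eq_0: "ballot D n \<Longrightarrow> height D n < k \<Longrightarrow> seminormal Q D n k = 0"
proof (induction n arbitrary: k)
  case (Suc n)
  show ?case
  proof (cases "Suc n \<in> D")
    case True
    then have "height D n < Suc k" using Suc.prems by simp
    then have "seminormal Q D n (Suc k) = 0" using Suc.prems by (intro Suc.IH) simp_all
    moreover have "seminormal Q D n k = 0 \<or> qnum Q (height D n) = qnum Q k"
    proof (cases "k = height D n")
      case False
      then have "height D n < k" using Suc.prems True by simp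
      then have "seminormal Q D n k = 0" using Suc.prems by (intro Suc.IH) simp_all
      then show ?thesis ..
    qed simp
    ultimately show ?thesis using True by auto
  next
    case False
    then have "seminormal Q D n k = 0" "seminormal Q D n (k - 1) = 0" using Suc.prems by (auto intro!: Suc.IH)
    note z = this
    show ?thesis unfolding seminormal.simps z using False by simp
  qed
qed simp

text \<open>Exchanging the steps \<open>i\<close> and \<open>i + 1\<close> of a path.\<close>
abbreviation swap_step :: "nat \<Rightarrow> nat set \<Rightarrow> nat set" where
  "swap_step i D \<equiv> transpose i (Suc i) ` D"

lemma mem_swap_step: "p \<in> swap_step i D \<longleftrightarrow> transpose i (Suc i) p \<in> D"
  by (metis image_iff transpose_involutory)

lemma swap_step_Int_below: "n < i \<Longrightarrow> swap_step i D \<inter> {1..n} = D \<inter> {1..n}"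
  by (auto simp: mem_swap_step transpose_def split: if_splits)

section \<open>The action of the generators on the seminormal vectors\<close>

lemmas entry_linear_simps = append_entry_add append_entry_diff append_entry_minus append_entry_scale
  hecke_T_add hecke_T_diff hecke_T_minus hecke_T_scale
  cvs.scale_right_distrib cvs.scale_right_diff_distrib

text \<open>The next four lemmas treat the generator that acts on the last two entries, according to the last two steps of
  the path: both in the same direction, up--down or down--up from a positive height, and up--down from height 0.
  They hold for all \<open>k\<close>, and all coefficients are independent of \<open>k\<close>; this is what makes the recursion step below
  possible. The height of the path before the two steps is \<open>height D n\<close>.\<close>
lemma hecke_T_seminormal_last_same:
  assumes "Suc n \<in> D \<longleftrightarrow> Suc (Suc n) \<in> D" "ballot D (Suc (Suc n))"
  shows "hecke_T Q (Suc n) (seminormal Q D (Suc (Suc n)) k) = cscale Q (seminormal Q D (Suc (Suc n)) k)"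
proof -
  let ?E = "\<lambda>a b f. append_entry (Suc (Suc n)) b (append_entry (Suc n) a f)"
  note T = hecke_T_append_two[where Q = Q and i = "Suc n"]
  show ?thesis
  proof (cases "Suc n \<in> D")
    case False
    then show ?thesis using assms
      by (simp add: entry_linear_simps T)
         (simp add: cscale_def fun_eq_iff algebra_simps)
  next
    case True
    then obtain h where h: "height D n = Suc (Suc h)" using assms
      by (metis One_nat_def Suc_pred ballot.simps(2) diff_Suc_1 height.simps(2) )
    show ?thesis using assms True h
      by (simp add: entry_linear_simps T)
         (simp add: cscale_def fun_eq_iff algebra_simps qnum_Suc)
  qed
qed

lemma hecke_T_seminormal_last_ud:
  assumes "Suc n \<notin> D" "Suc (Suc n) \<in> D" "0 < height D n"
  shows "cscale (qnum Q (Suc (height D n))) (hecke_T Q (Suc n) (seminormal Q D (Suc (Suc n)) k)) =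
    cscale (-1) (seminormal Q D (Suc (Suc n)) k) +
    cscale (- qnum Q (Suc (Suc (height D n)))) (seminormal Q (swap_step (Suc n) D) (Suc (Suc n)) k)"
proof -
  note T = hecke_T_append_two[where Q = Q and i = "Suc n"]
  have swap_step: "Suc n \<in> swap_step (Suc n) D" "Suc (Suc n) \<notin> swap_step (Suc n) D"
    using assms by (auto simp: mem_swap_step)
  have int: "swap_step (Suc n) D \<inter> {1..n} = D \<inter> {1..n}" by (rule swap_step_Int_below) simp
  note cong = height_cong[OF int] downs_cong[OF int] seminormal_cong[OF int]
  obtain h where h: "height D n = Suc h" using assms(3) gr0_implies_Suc by blast
  show ?thesis
  proof (cases k)
    case 0
    then show ?thesis using assms h swap_step
      by (simp add: entry_linear_simps T cong)
         (simp add: cscale_def fun_eq_iff algebra_simps qnum_Suc power2_eq_square)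
  next
    case (Suc l)
    then show ?thesis using assms h swap_step
      by (simp add: entry_linear_simps T cong)
         (simp add: cscale_def fun_eq_iff algebra_simps qnum_Suc power2_eq_square)
  qed
qed

lemma hecke_T_seminormal_last_du:
  assumes "Suc n \<in> D" "Suc (Suc n) \<notin> D" "0 < height D n"
  shows "cscale (qnum Q (Suc (height D n))) (hecke_T Q (Suc n) (seminormal Q D (Suc (Suc n)) k)) =
    cscale (Q ^ Suc (height D n)) (seminormal Q D (Suc (Suc n)) k) +
    cscale (- (Q * qnum Q (height D n))) (seminormal Q (swap_step (Suc n) D) (Suc (Suc n)) k)"
proof -
  note T = hecke_T_append_two[where Q = Q and i = "Suc n"]
  have swap_step: "Suc n \<notin> swap_step (Suc n) D" "Suc (Suc n) \<in> swap_step (Suc n) D"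
    using assms by (auto simp: mem_swap_step)
  have int: "swap_step (Suc n) D \<inter> {1..n} = D \<inter> {1..n}" by (rule swap_step_Int_below) simp
  note cong = height_cong[OF int] downs_cong[OF int] seminormal_cong[OF int]
  have Qh: "Q ^ height D n = qnum Q (Suc (height D n)) - qnum Q (height D n)" by (simp add: qnum_Suc')
  obtain h where h: "height D n = Suc h" using assms(3) gr0_implies_Suc by blast
  show ?thesis
  proof (cases k)
    case 0
    then show ?thesis using assms h swap_step
      by (simp add: entry_linear_simps T cong)
         (simp add: Qh[unfolded h, simplified] cscale_def fun_eq_iff algebra_simps qnum_Suc power2_eq_square)
  next
    case (Suc l)
    then show ?thesis using assms h swap_step
      by (simp add: entry_linear_simps T cong)
         (simp add: Qh[unfolded h, simplified] cscale_def fun_eq_iff algebra_simps qnum_Suc power2_eq_square)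
  qed
qed

lemma hecke_T_seminormal_last_ground:
  assumes "Suc n \<notin> D" "Suc (Suc n) \<in> D" "height D n = 0" "ballot D n"
  shows "hecke_T Q (Suc n) (seminormal Q D (Suc (Suc n)) k) = cscale (-1) (seminormal Q D (Suc (Suc n)) k)"
proof -
  note T = hecke_T_append_two[where Q = Q and i = "Suc n"]
  have z: "seminormal Q D n (Suc k) = 0" for k using seminormal_eq_0 assms by simp
  show ?thesis
  proof (cases k)
    case 0
    then show ?thesis using assms z
      by (simp add: entry_linear_simps T)
         (simp add: cscale_def fun_eq_iff algebra_simps qnum_Suc power2_eq_square)
  next
    case (Suc l)
    then show ?thesis using assms z
      by (simp add: entry_linear_simps T)
         (cases l; simp add: z cscale_def fun_eq_iff algebra_simps qnum_Suc power2_eq_square)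
  qed
qed

lemma height_downs_ext:
  assumes "height D' j = height D j" "downs D' j = downs D j" "\<And>p. j < p \<Longrightarrow> p \<in> D' \<longleftrightarrow> p \<in> D" "j \<le> n"
  shows "height D' n = height D n \<and> downs D' n = downs D n"
  using assms(4) by (induction n rule: dec_induct) (simp_all add: assms)

text \<open>Further entries do not disturb a relation between the vectors of two paths, provided that the paths have the
  same later steps and start them at the same height and after equally many down steps: the generator commutes with appending entries, and
  the coefficients of the recursion agree for the two paths.\<close>
lemma hecke_T_seminormal_lift:
  assumes base: "\<And>k. cscale c (hecke_T Q i (seminormal Q D (Suc i) k)) =
      cscale a (seminormal Q D (Suc i) k) + cscale b (seminormal Q D' (Suc i) k)"
    and D': "height D' (Suc i) = height D (Suc i)" "downs D' (Suc i) = downs D (Suc i)"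
      "\<And>p. Suc i < p \<Longrightarrow> p \<in> D' \<longleftrightarrow> p \<in> D"
    and "Suc i \<le> n"
  shows "cscale c (hecke_T Q i (seminormal Q D n k)) = cscale a (seminormal Q D n k) + cscale b (seminormal Q D' n k)"
  using \<open>Suc i \<le> n\<close>
proof (induction n arbitrary: k rule: dec_induct)
  case base
  show ?case by (rule assms(1))
next
  case (step n)
  have hd: "height D' n = height D n" "downs D' n = downs D n"
    using height_downs_ext[OF D', of n] step by simp_all
  have mem: "Suc n \<in> D' \<longleftrightarrow> Suc n \<in> D" using D'(3)[of "Suc n"] step by simp
  have T: "cscale c (hecke_T Q i (append_entry (Suc n) e (seminormal Q D n k))) =
     cscale a (append_entry (Suc n) e (seminormal Q D n k)) + cscale b (append_entry (Suc n) e (seminormal Q D' n k))"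
    for e k
  proof -
    have less: "Suc i < Suc n" using step by simp
    have "cscale c (hecke_T Q i (append_entry (Suc n) e (seminormal Q D n k))) =
      append_entry (Suc n) e (cscale c (hecke_T Q i (seminormal Q D n k)))"
      unfolding hecke_T_append[OF less] append_entry_scale ..
    also have "\<dots> = cscale a (append_entry (Suc n) e (seminormal Q D n k)) +
        cscale b (append_entry (Suc n) e (seminormal Q D' n k))"
      unfolding step.IH append_entry_add append_entry_scale ..
    finally show ?thesis .
  qed
  have push: "cscale c (cscale x (f + cscale y g)) = cscale x (cscale c f + cscale y (cscale c g))"
    "cscale c (f + cscale y g) = cscale c f + cscale y (cscale c g)" for x y and f g :: tabvec
    by (simp_all add: cscale_def fun_eq_iff algebra_simps)
  show ?case
  proof (cases "Suc n \<in> D")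
    case True
    show ?thesis
      unfolding seminormal.simps hd mem if_P[OF True]
      unfolding hecke_T_add hecke_T_scale push T
      by (simp add: cscale_def fun_eq_iff algebra_simps)
  next
    case False
    show ?thesis
      unfolding seminormal.simps hd mem if_not_P[OF False]
      unfolding hecke_T_add hecke_T_scale push T
      by (simp add: cscale_def fun_eq_iff algebra_simps)
  qed
qed

lemma swap_step_above: "Suc i < p \<Longrightarrow> p \<in> swap_step i D \<longleftrightarrow> p \<in> D"
  unfolding mem_swap_step by (simp add: transpose_def)

text \<open>Below, \<open>T\<^bsub>l+1\<^esub>\<close> acts on the steps \<open>l + 1\<close> and \<open>l + 2\<close>, which start from the height after \<open>l\<close> steps.\<close>
lemma hecke_T_seminormal_same:
  assumes "Suc l \<in> D \<longleftrightarrow> Suc (Suc l) \<in> D" "ballot D n" "Suc l < n"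
  shows "hecke_T Q (Suc l) (seminormal Q D n k) = cscale Q (seminormal Q D n k)"
proof -
  have "ballot D (Suc (Suc l))" using assms ballot_mono by (metis Suc_leI)
  note hecke_T_seminormal_last_same[OF assms(1) this]
  then show ?thesis
    using hecke_T_seminormal_lift[of 1 Q "Suc l" D Q 0 D n k] assms(3) by simp
qed

lemma hecke_T_seminormal_ground:
  assumes "Suc l \<notin> D" "Suc (Suc l) \<in> D" "height D l = 0" "ballot D n" "Suc l < n"
  shows "hecke_T Q (Suc l) (seminormal Q D n k) = cscale (-1) (seminormal Q D n k)"
proof -
  have "ballot D l" using assms ballot_mono by (metis Suc_lessD less_imp_le)
  note hecke_T_seminormal_last_ground[OF assms(1-3) this]
  then show ?thesis
    using hecke_T_seminormal_lift[of 1 Q "Suc l" D "-1" 0 D n k] assms(5) by simp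
qed

lemma swap_step_height_downs:
  assumes "(Suc l \<in> D) \<noteq> (Suc (Suc l) \<in> D)" "0 < height D l"
  shows "height (swap_step (Suc l) D) (Suc (Suc l)) = height D (Suc (Suc l))"
    "downs (swap_step (Suc l) D) (Suc (Suc l)) = downs D (Suc (Suc l))"
proof -
  have int: "swap_step (Suc l) D \<inter> {1..l} = D \<inter> {1..l}" by (rule swap_step_Int_below) simp
  show "height (swap_step (Suc l) D) (Suc (Suc l)) = height D (Suc (Suc l))"
    "downs (swap_step (Suc l) D) (Suc (Suc l)) = downs D (Suc (Suc l))"
    using assms by (auto simp: mem_swap_step height_cong[OF int] downs_cong[OF int])
qed

lemma hecke_T_seminormal_ud:
  assumes "Suc l \<notin> D" "Suc (Suc l) \<in> D" "0 < height D l" "Suc l < n"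
  shows "cscale (qnum Q (Suc (height D l))) (hecke_T Q (Suc l) (seminormal Q D n k)) =
    cscale (-1) (seminormal Q D n k) +
    cscale (- qnum Q (Suc (Suc (height D l)))) (seminormal Q (swap_step (Suc l) D) n k)"
  using hecke_T_seminormal_lift[OF hecke_T_seminormal_last_ud[OF assms(1-3)] swap_step_height_downs[of l D] swap_step_above[of "Suc l"]]
    assms by simp

lemma hecke_T_seminormal_du:
  assumes "Suc l \<in> D" "Suc (Suc l) \<notin> D" "0 < height D l" "Suc l < n"
  shows "cscale (qnum Q (Suc (height D l))) (hecke_T Q (Suc l) (seminormal Q D n k)) =
    cscale (Q ^ Suc (height D l)) (seminormal Q D n k) +
    cscale (- (Q * qnum Q (height D l))) (seminormal Q (swap_step (Suc l) D) n k)"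
  using hecke_T_seminormal_lift[OF hecke_T_seminormal_last_du[OF assms(1-3)] swap_step_height_downs[of l D] swap_step_above[of "Suc l"]]
    assms by simp

section \<open>Linear independence of the seminormal vectors\<close>

lemma append_entry_disjoint:
  assumes "a \<noteq> b" "\<And>w. f w \<noteq> 0 \<Longrightarrow> w p = 0" "\<And>w. g w \<noteq> 0 \<Longrightarrow> w p = 0"
     and "append_entry p a f + append_entry p b g = 0"
  shows "f = 0 \<and> g = 0"
proof -
  have "f w = 0" for w
  proof (cases "w p = 0")
    case True
    have "(append_entry p a f + append_entry p b g) (w(p := a)) = 0" by (simp add: assms(4))
    then show ?thesis using assms(1) True by (simp add: append_entry_def fun_upd_idem)
  qed (use assms(2)[of w] in auto)
  moreover have "g w = 0" for w
  proof (cases "w p = 0")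
    case True
    have "(append_entry p a f + append_entry p b g) (w(p := b)) = 0" by (simp add: assms(4))
    then show ?thesis using assms(1) True by (simp add: append_entry_def fun_upd_idem)
  qed (use assms(3)[of w] in auto)
  ultimately show ?thesis by (simp add: fun_eq_iff)
qed

lemma seminormal_support: "n < p \<Longrightarrow> seminormal Q D n k w \<noteq> 0 \<Longrightarrow> w p = 0"
proof (induction n arbitrary: k w)
  case 0
  then show ?case by (auto simp: tabloid_basis_def split: if_splits)
next
  case (Suc n)
  have "p \<noteq> Suc n" "n < p" using Suc by auto
  have z: "append_entry (Suc n) a (seminormal Q D n k) w = 0" if "w p \<noteq> 0" for a k
  proof -
    have "seminormal Q D n k (w(Suc n := 0)) = 0"
    proof (rule ccontr)
      assume "seminormal Q D n k (w(Suc n := 0)) \<noteq> 0"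
      from Suc.IH[OF \<open>n < p\<close> this] show False using that \<open>p \<noteq> Suc n\<close> by simp
    qed
    then show ?thesis by (simp only: append_entry_def if_cancel)
  qed
  show ?case
  proof (rule ccontr)
    assume "w p \<noteq> 0"
    note z = z[OF this]
    have "seminormal Q D (Suc n) k w = 0"
      unfolding seminormal.simps by (simp add: cscale_def z)
    then show False using Suc.prems by simp
  qed
qed

text \<open>The part of a linear combination in which the last entry lies in row 2 involves only the paths that end with a
  down step, with nonzero factors; it isolates their coefficients. Paths are compared by their first \<open>n\<close> steps
  only, so that the induction need not truncate the sets.\<close>
lemma seminormal_family_independent:
  assumes "\<And>k. 0 < k \<Longrightarrow> qnum Q k \<noteq> 0" "Q \<noteq> 0"
    and "finite S" "inj_on (\<lambda>D. D \<inter> {1..n}) S" "\<And>D. D \<in> S \<Longrightarrow> ballot D n"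
    and "(\<Sum>D\<in>S. cscale (c D) (seminormal Q D n 0)) = 0" "D \<in> S"
  shows "c D = 0"
  using assms(3-)
proof (induction n arbitrary: S c D)
  case 0
  have "S = {D}"
    using 0 by (auto simp: inj_on_def)
  then have "cscale (c D) (tabloid_basis (\<lambda>_. 0)) (\<lambda>_. 0) = 0"
    using 0(4) by (metis (no_types, lifting) sum.empty sum.insert seminormal.simps(1) finite.emptyI
        empty_iff add_0_right zero_fun_apply)
  then show ?case by (simp add: cscale_def tabloid_basis_def)
next
  case (Suc n)
  define S1 where "S1 = {D \<in> S. Suc n \<in> D}"
  define S2 where "S2 = {D \<in> S. Suc n \<notin> D}"
  have S: "S = S1 \<union> S2" "S1 \<inter> S2 = {}" and fin: "finite S1" "finite S2"
    using Suc.prems(1) by (auto simp: S1_def S2_def)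
  have int: "D \<inter> {1..Suc n} = (if Suc n \<in> D then insert (Suc n) (D \<inter> {1..n}) else D \<inter> {1..n})" for D
    by (auto simp: atLeastAtMostSuc_conv)
  have inj: "inj_on (\<lambda>D. D \<inter> {1..n}) S1" "inj_on (\<lambda>D. D \<inter> {1..n}) S2"
    using Suc.prems(2) unfolding inj_on_def int S1_def S2_def by auto
  have bal: "ballot D n" if "D \<in> S" for D using Suc.prems(3)[OF that] by simp
  define e where "e = (\<lambda>D. c D * (-1) ^ height D n * (- (Q ^ Suc (downs D n) * qnum Q (height D n))))"
  \<comment> \<open>the parts of the linear combination with the last entry in row 1 and in row 2\<close>
  define F where "F = (\<Sum>D\<in>S1. cscale (c D * (-1) ^ height D n) (seminormal Q D n 1)) +
     (\<Sum>D\<in>S2. cscale (c D) (seminormal Q D n 0))"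
  define G where "G = (\<Sum>D\<in>S1. cscale (e D) (seminormal Q D n 0))"
  have "append_entry (Suc n) 1 F + append_entry (Suc n) 2 G =
     (\<Sum>D\<in>S1. cscale (c D) (seminormal Q D (Suc n) 0)) + (\<Sum>D\<in>S2. cscale (c D) (seminormal Q D (Suc n) 0))"
  proof -
    have "(\<Sum>D\<in>S1. cscale (c D) (seminormal Q D (Suc n) 0)) =
      (\<Sum>D\<in>S1. cscale (c D * (-1) ^ height D n) (append_entry (Suc n) 1 (seminormal Q D n 1)) +
               cscale (e D) (append_entry (Suc n) 2 (seminormal Q D n 0)))"
      by (rule sum.cong) (simp_all add: S1_def e_def cvs.scale_right_diff_distrib)
    moreover have "(\<Sum>D\<in>S2. cscale (c D) (seminormal Q D (Suc n) 0)) =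
      (\<Sum>D\<in>S2. cscale (c D) (append_entry (Suc n) 1 (seminormal Q D n 0)))"
      by (rule sum.cong) (simp_all add: S2_def)
    ultimately show ?thesis
      unfolding F_def G_def append_entry_add append_entry_sum append_entry_scale sum.distrib
      by (simp only: add_ac)
  qed
  also have "\<dots> = 0"
    unfolding sum.union_disjoint[OF fin S(2), symmetric] S(1)[symmetric] by (rule Suc.prems(4))
  finally have "append_entry (Suc n) 1 F + append_entry (Suc n) 2 G = 0" .
  moreover have supp: "w (Suc n) = 0" if "(\<Sum>D\<in>A. cscale (f D) (seminormal Q D n k)) w \<noteq> 0" for A f k w
  proof -
    have "(\<Sum>D\<in>A. cscale (f D) (seminormal Q D n k)) w = (\<Sum>D\<in>A. f D * seminormal Q D n k w)"
      by (induction A rule: infinite_finite_induct) (auto simp: cscale_def)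
    then have "(\<Sum>D\<in>A. f D * seminormal Q D n k w) \<noteq> 0" using that by (simp only: simp_thms)
    then obtain D where "f D * seminormal Q D n k w \<noteq> 0" by (rule sum.not_neutral_contains_not_neutral)
    then have "seminormal Q D n k w \<noteq> 0" by simp
    then show ?thesis using seminormal_support[of n "Suc n"] by blast
  qed
  moreover have "w (Suc n) = 0" if "F w \<noteq> 0" for w
  proof -
    have "(\<Sum>D\<in>S1. cscale (c D * (-1) ^ height D n) (seminormal Q D n 1)) w \<noteq> 0 \<or>
     (\<Sum>D\<in>S2. cscale (c D) (seminormal Q D n 0)) w \<noteq> 0"
      using that unfolding F_def plus_fun_apply by auto
    then show ?thesis by (elim disjE) (erule supp)+
  qed
  moreover have "w (Suc n) = 0" if "G w \<noteq> 0" for w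
    using that unfolding G_def by (rule supp)
  ultimately have FG: "F = 0" "G = 0"
    using append_entry_disjoint[of 1 2 F "Suc n" G] by (auto simp del: zero_fun_apply)
  have "e D = 0" if "D \<in> S1" for D
    using Suc.IH[OF fin(1) inj(1) _ FG(2)[unfolded G_def] that] bal S(1) by blast
  moreover have "qnum Q (height D n) \<noteq> 0" if "D \<in> S1" for D
    using Suc.prems(3)[of D] that assms(1) by (simp add: S1_def)
  ultimately have c1: "c D = 0" if "D \<in> S1" for D
    using that assms(2) by (simp add: e_def)
  have "(\<Sum>D\<in>S1. cscale (c D * (-1) ^ height D n) (seminormal Q D n 1)) = 0"
    by (intro sum.neutral ballI) (simp only: c1 mult_zero_left cvs.scale_zero_left)
  then have "F = (\<Sum>D\<in>S2. cscale (c D) (seminormal Q D n 0))"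
    unfolding F_def by (simp only: add_0)
  then have "c D = 0" if "D \<in> S2" for D
    using Suc.IH[OF fin(2) inj(2) _ trans[OF sym FG(1)] that] bal S(1) by blast
  with c1 Suc.prems(5) S(1) show ?case by blast
qed

text \<open>Independence of a family, in terms of its coefficients, gives its injectivity and the independence of its
  set of values.\<close>
lemma family_independentD:
  fixes x :: "'a \<Rightarrow> ('b \<Rightarrow> complex)"
  assumes "finite P" and ind: "\<And>c D. (\<Sum>D\<in>P. cscale (c D) (x D)) = 0 \<Longrightarrow> D \<in> P \<Longrightarrow> c D = 0"
  shows "inj_on x P" "cvs.independent (x ` P)"
proof -
  show inj: "inj_on x P"
  proof (rule inj_onI, rule ccontr)
    fix D E assume DE: "D \<in> P" "E \<in> P" "x D = x E" "D \<noteq> E"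
    define c :: "'a \<Rightarrow> complex" where "c = (\<lambda>F. if F = D then 1 else if F = E then -1 else 0)"
    have "(\<Sum>F\<in>P. cscale (c F) (x F)) = (\<Sum>F\<in>{D, E}. cscale (c F) (x F))"
      using assms(1) DE by (intro sum.mono_neutral_right) (auto simp: c_def)
    also have "\<dots> = 0" using DE by (simp add: c_def)
    finally have "c D = 0" using ind DE(1) by blast
    then show False by (simp add: c_def)
  qed
  show "cvs.independent (x ` P)"
  proof
    assume "cvs.dependent (x ` P)"
    then obtain u v where u: "v \<in> x ` P" "u v \<noteq> 0" "(\<Sum>v\<in>x ` P. cscale (u v) v) = 0"
      using cvs.dependent_finite[of "x ` P"] assms(1) by auto
    have "(\<Sum>D\<in>P. cscale (u (x D)) (x D)) = 0"
      using u(3) sum.reindex[OF inj, of "\<lambda>v. cscale (u v) v"] by (simp add: comp_def)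
    from ind[OF this] u(1,2) show False by blast
  qed
qed

section \<open>Quantum integers and norms of paths\<close>

lemma qnum_geometric: "(Q - 1) * qnum Q k = Q ^ k - 1"
  by (induction k) (simp_all add: qnum_Suc' algebra_simps)

text \<open>The quantum integer \<open>[[k]]\<^sub>q\<close> as a real number, which it is for \<open>q\<close> on the unit circle.\<close>
definition rquantum :: "complex \<Rightarrow> nat \<Rightarrow> real" where
  "rquantum q k = Re (quantum_int q (int k))"

lemma rquantum_0 [simp]: "rquantum q 0 = 0"
  by (simp add: rquantum_def quantum_int_def)

text \<open>The product of \<open>[[d]]\<^sub>q [[d+1]]\<^sub>q\<close> over all down steps, where \<open>d\<close> is the height from which the step goes down. These
  are the norms of the vectors of the paths in the suitably normalised invariant form.\<close>
primrec path_norm :: "complex \<Rightarrow> nat set \<Rightarrow> nat \<Rightarrow> real" where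
  "path_norm q D 0 = 1"
| "path_norm q D (Suc n) = path_norm q D n *
     (if Suc n \<in> D then rquantum q (height D n) * rquantum q (Suc (height D n)) else 1)"

lemma path_norm_cong: "D \<inter> {1..n} = D' \<inter> {1..n} \<Longrightarrow> path_norm q D n = path_norm q D' n"
proof (induction n)
  case (Suc n)
  have "Suc n \<in> D \<longleftrightarrow> Suc n \<in> D'"
    using Suc.prems by (metis IntD1 IntI atLeastAtMost_iff le_refl Suc_le_mono One_nat_def le0)
  moreover have *: "D \<inter> {1..n} = D' \<inter> {1..n}"
    using Suc.prems by (auto simp: atLeastAtMostSuc_conv set_eq_iff)
  ultimately show ?case using Suc.IH height_cong[OF *] by simp
qed simp

text \<open>The steps \<open>l + 1\<close> and \<open>l + 2\<close> have different directions and start from a positive height, so that exchanging them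
  turns ballot paths into ballot paths.\<close>
definition swappable :: "nat \<Rightarrow> nat set \<Rightarrow> bool" where
  "swappable l D \<longleftrightarrow> (Suc l \<in> D) \<noteq> (Suc (Suc l) \<in> D) \<and> 0 < height D l"

lemma swap_step_involutive: "swap_step i (swap_step i D) = D"
  by (auto simp: mem_swap_step)

lemma height_swap_step: "height (swap_step (Suc l) D) l = height D l"
  by (rule height_cong, rule swap_step_Int_below) simp

lemma swappable_swap_step: "swappable l (swap_step (Suc l) D) \<longleftrightarrow> swappable l D"
  by (auto simp: swappable_def height_swap_step mem_swap_step)

lemma ballot_ext:
  assumes "height D' j = height D j" "downs D' j = downs D j" "\<And>p. j < p \<Longrightarrow> p \<in> D' \<longleftrightarrow> p \<in> D" "j \<le> n"
    "ballot D' j" "ballot D n"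
  shows "ballot D' n"
  using assms(4,6)
proof (induction n rule: dec_induct)
  case (step n)
  then show ?case using height_downs_ext[OF assms(1-3), of n] assms(3)[of "Suc n"] by simp
qed (rule assms(5))

lemma ballot_swap_step:
  assumes "swappable l D" "Suc l < n" "ballot D n"
  shows "ballot (swap_step (Suc l) D) n"
proof -
  have int: "swap_step (Suc l) D \<inter> {1..l} = D \<inter> {1..l}" by (rule swap_step_Int_below) simp
  have "ballot D l" using assms ballot_mono by (metis Suc_lessD less_imp_le)
  then have "ballot (swap_step (Suc l) D) (Suc (Suc l))"
    using assms(1) unfolding swappable_def ballot.simps
    by (auto simp: mem_swap_step height_cong[OF int] ballot_cong[OF int])
  then show ?thesis
    using ballot_ext[OF swap_step_height_downs[of l D] swap_step_above[of "Suc l"] _ _ assms(3)] assms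
    by (auto simp: swappable_def)
qed

text \<open>With \<open>d = height D l\<close>, the down step starts from height \<open>d + 1\<close> in \<open>D\<close> and from height \<open>d\<close> in the path with the two
  steps exchanged; the common factor \<open>[[d+1]]\<^sub>q\<close> cancels.\<close>
lemma path_norm_swap_step:
  assumes "swappable l D" "Suc (Suc l) \<in> D" "Suc l < n"
  shows "path_norm q D n * rquantum q (height D l) = path_norm q (swap_step (Suc l) D) n * rquantum q (Suc (Suc (height D l)))"
proof -
  have "Suc (Suc l) \<le> n" using assms by simp
  then show ?thesis
  proof (induction n rule: dec_induct)
    case base
    have int: "swap_step (Suc l) D \<inter> {1..l} = D \<inter> {1..l}" by (rule swap_step_Int_below) simp
    show ?case using assms
      by (auto simp: swappable_def mem_swap_step height_swap_step path_norm_cong[OF int])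
  next
    case (step n)
    have "height (swap_step (Suc l) D) n = height D n"
      using height_downs_ext[OF swap_step_height_downs[of l D] swap_step_above[of "Suc l"], of n] step assms
      by (auto simp: swappable_def)
    then show ?case using step swap_step_above[of "Suc l" "Suc n" D]
      by (auto simp: algebra_simps)
  qed
qed

section \<open>The matrices of the generators are unitary\<close>

locale generic_unit =
  fixes q :: complex
  assumes norm_q: "cmod q = 1" and not_root: "\<And>k::nat. 0 < k \<Longrightarrow> q ^ k \<noteq> 1"
begin

abbreviation Q :: complex where "Q \<equiv> q\<^sup>2"
abbreviation r :: "nat \<Rightarrow> real" where "r \<equiv> rquantum q"

lemma q_nz: "q \<noteq> 0"
  using norm_q by auto

lemma cnj_q: "cnj q = inverse q"
  using norm_q by (metis complex_norm_square inverse_unique mult.commute norm_one of_real_1 power_one)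

lemma Q_power_ne_1: "0 < k \<Longrightarrow> Q ^ k \<noteq> 1"
  using not_root[of "2 * k"] by (simp add: power_mult)

lemma Q_ne_1: "Q \<noteq> 1"
  using Q_power_ne_1[of 1] by simp

lemma qnum_nz: "0 < k \<Longrightarrow> qnum Q k \<noteq> 0"
  using qnum_geometric[of Q k] Q_power_ne_1[of k] by auto

text \<open>The two normalisations of quantum integers differ by a power of \<open>q\<close>, hence by a factor of modulus 1.\<close>
lemma qnum_rquantum: "q * qnum Q k = q ^ k * of_real (r k)"
proof -
  have nz: "q - inverse q \<noteq> 0"
    using Q_ne_1 q_nz by (auto simp: field_simps power2_eq_square)
  have "of_real (r k) = quantum_int q (int k)"
    using quantum_int_real[OF norm_q, of "int k"] by (simp add: rquantum_def of_real_Re)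
  then have "of_real (r k) * (q - inverse q) = q ^ k - inverse (q ^ k)"
    using nz by (simp add: quantum_int_def power_int_minus)
  then have "q ^ k * (of_real (r k) * (q - inverse q)) = q ^ k * (q ^ k - inverse (q ^ k))"
    by (rule arg_cong)
  also have "\<dots> = Q ^ k - 1"
    using q_nz by (simp add: right_diff_distrib power_mult_distrib[symmetric] power2_eq_square)
  also have "\<dots> = q * qnum Q k * (q - inverse q)"
  proof -
    have "Q - 1 = q * (q - inverse q)" using q_nz by (simp add: right_diff_distrib power2_eq_square)
    then show ?thesis unfolding qnum_geometric[symmetric] by (simp only: mult_ac)
  qed
  finally show ?thesis using nz by (simp only: mult.assoc[symmetric] mult_cancel_right) simp
qed

lemma qnum_Suc_rquantum: "qnum Q (Suc k) = q ^ k * of_real (r (Suc k))"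
  using qnum_rquantum[of "Suc k"] q_nz by simp

lemma r_nz: "0 < k \<Longrightarrow> r k \<noteq> 0"
  using qnum_rquantum[of k] qnum_nz[of k] q_nz by auto

lemma r_square: "(r (Suc d))\<^sup>2 = 1 + r d * r (Suc (Suc d))"
proof -
  define A where "A = qnum Q d"
  have "(qnum Q (Suc d))\<^sup>2 = Q ^ d + qnum Q d * qnum Q (Suc (Suc d))"
  proof -
    have Qd: "Q ^ d = 1 + (Q - 1) * A" by (simp add: A_def qnum_geometric)
    show ?thesis unfolding qnum_Suc Qd A_def[symmetric] by algebra
  qed
  then have "(q * qnum Q (Suc d))\<^sup>2 = q^2 * Q ^ d + (q * qnum Q d) * (q * qnum Q (Suc (Suc d)))"
    by (simp add: power_mult_distrib power2_eq_square algebra_simps)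
  then have "q^2 * Q ^ d * of_real ((r (Suc d))\<^sup>2) = q^2 * Q ^ d * of_real (1 + r d * r (Suc (Suc d)))"
    unfolding qnum_rquantum by (simp add: power2_eq_square power_mult_distrib algebra_simps)
  then have "complex_of_real ((r (Suc d))\<^sup>2) = of_real (1 + r d * r (Suc (Suc d)))"
    using q_nz by simp
  then show ?thesis by (simp only: of_real_eq_iff)
qed

lemma path_norm_nz: "ballot D n \<Longrightarrow> path_norm q D n \<noteq> 0"
  by (induction n) (auto simp: r_nz)

text \<open>The matrix of \<open>T\<^bsub>l+1\<^esub>\<close> in the seminormal basis: \<open>T\<^bsub>l+1\<^esub> x\<^sub>D\<close> is \<open>diag_coeff l D\<close> times \<open>x\<^sub>D\<close> plus \<open>off_coeff l D\<close> times
  the vector of the partner of \<open>D\<close>, in which the two steps are exchanged. A path with no admissible exchange is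
  its own partner, and then the second coefficient is 0.\<close>
definition diag_coeff :: "nat \<Rightarrow> nat set \<Rightarrow> complex" where
  "diag_coeff l D = (if Suc l \<in> D \<longleftrightarrow> Suc (Suc l) \<in> D then Q
     else if height D l = 0 then -1
     else if Suc (Suc l) \<in> D then - inverse (qnum Q (Suc (height D l)))
     else Q ^ Suc (height D l) / qnum Q (Suc (height D l)))"

definition off_coeff :: "nat \<Rightarrow> nat set \<Rightarrow> complex" where
  "off_coeff l D = (if \<not> swappable l D then 0
     else if Suc (Suc l) \<in> D then - (qnum Q (Suc (Suc (height D l))) / qnum Q (Suc (height D l)))
     else - (Q * qnum Q (height D l) / qnum Q (Suc (height D l))))"

definition partner :: "nat \<Rightarrow> nat set \<Rightarrow> nat set" where
  "partner l D = (if swappable l D then swap_step (Suc l) D else D)"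

lemma partner_partner: "partner l (partner l D) = D"
  by (simp add: partner_def swappable_swap_step swap_step_involutive)

lemma ballot_partner: "ballot D n \<Longrightarrow> Suc l < n \<Longrightarrow> ballot (partner l D) n"
  by (simp add: partner_def ballot_swap_step)

lemma ballot_height_pos:
  assumes "ballot D n" "Suc l < n" "Suc l \<in> D"
  shows "0 < height D l"
  using ballot_mono[of D n "Suc l"] assms by simp

lemma hecke_T_seminormal:
  assumes "ballot D n" "Suc l < n"
  shows "hecke_T Q (Suc l) (seminormal Q D n k) =
    cscale (diag_coeff l D) (seminormal Q D n k) + cscale (off_coeff l D) (seminormal Q (partner l D) n k)"
proof -
  have nz: "qnum Q (Suc (height D l)) \<noteq> 0" by (simp add: qnum_nz)
  have *: "v = cscale (a / c) u + cscale (b / c) w"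
    if "cscale c v = cscale a u + cscale b w" "c \<noteq> 0" for a b c and u v w :: tabvec
  proof -
    have "v = cscale (inverse c) (cscale c v)" using that(2) by simp
    also have "\<dots> = cscale (a / c) u + cscale (b / c) w"
      unfolding that(1) by (simp add: cscale_def fun_eq_iff field_simps add_divide_distrib)
    finally show ?thesis .
  qed
  consider "Suc l \<in> D \<longleftrightarrow> Suc (Suc l) \<in> D" | "Suc l \<notin> D" "Suc (Suc l) \<in> D" "height D l = 0"
    | "Suc l \<notin> D" "Suc (Suc l) \<in> D" "0 < height D l" | "Suc l \<in> D" "Suc (Suc l) \<notin> D" "0 < height D l"
    using ballot_height_pos[OF assms]
    by (cases "Suc l \<in> D"; cases "Suc (Suc l) \<in> D"; cases "height D l = 0") auto
  then show ?thesis
  proof cases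
    case 1
    then show ?thesis using hecke_T_seminormal_same[OF 1 assms]
      by (simp add: diag_coeff_def off_coeff_def swappable_def)
  next
    case 2
    then show ?thesis using hecke_T_seminormal_ground[OF 2 assms]
      by (simp add: diag_coeff_def off_coeff_def swappable_def)
  next
    case 3
    then have "diag_coeff l D = -1 / qnum Q (Suc (height D l))"
      "off_coeff l D = - qnum Q (Suc (Suc (height D l))) / qnum Q (Suc (height D l))" "partner l D = swap_step (Suc l) D"
      by (simp_all add: diag_coeff_def off_coeff_def swappable_def partner_def inverse_eq_divide)
    then show ?thesis using *[OF hecke_T_seminormal_ud[OF 3 assms(2)] nz] by (simp only:)
  next
    case 4
    then have "diag_coeff l D = Q ^ Suc (height D l) / qnum Q (Suc (height D l))"
      "off_coeff l D = - (Q * qnum Q (height D l)) / qnum Q (Suc (height D l))" "partner l D = swap_step (Suc l) D"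
      by (simp_all add: diag_coeff_def off_coeff_def swappable_def partner_def)
    then show ?thesis using *[OF hecke_T_seminormal_du[OF 4 assms(2)] nz] by (simp only:)
  qed
qed

lemma cmod_q_power: "cmod (q ^ k) = 1" by (simp add: norm_power norm_q)

lemma unit_times_cnj: "cmod a = 1 \<Longrightarrow> a * cnj a = 1"
  by (metis complex_norm_square of_real_1 power_one)

text \<open>The four matrix entries for an up--down pair \<open>D\<close> and the corresponding down--up pair \<open>E\<close>: each of them is a
  real number times a number of modulus 1.\<close>
lemma up_down_coeffs:
  assumes "swappable l D" "Suc (Suc l) \<in> D"
  defines "d \<equiv> height D l" and "E \<equiv> swap_step (Suc l) D"
  shows "diag_coeff l D = - inverse (q ^ d) / r (Suc d)" "off_coeff l D = - q * r (Suc (Suc d)) / r (Suc d)"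
    "diag_coeff l E = q ^ Suc (Suc d) / r (Suc d)" "off_coeff l E = - q * r d / r (Suc d)"
proof -
  have E: "swappable l E" "Suc l \<in> E" "Suc (Suc l) \<notin> E" "height E l = d"
    using assms by (auto simp: swappable_swap_step mem_swap_step swappable_def height_swap_step)
  have d: "d \<noteq> 0" "Suc l \<notin> D" using assms by (auto simp: swappable_def)
  have nz: "r (Suc d) \<noteq> 0" by (simp add: r_nz)
  show "diag_coeff l D = - inverse (q ^ d) / r (Suc d)" "off_coeff l D = - q * r (Suc (Suc d)) / r (Suc d)"
    using assms d q_nz nz by (simp_all add: diag_coeff_def off_coeff_def qnum_Suc_rquantum) (simp add: divide_inverse)
  have "Q ^ Suc d = q ^ d * q ^ Suc (Suc d)" by (simp add: power2_eq_square power_mult_distrib)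
  then show "diag_coeff l E = q ^ Suc (Suc d) / r (Suc d)"
    using E d q_nz nz by (simp add: diag_coeff_def qnum_Suc_rquantum del: power_Suc)
  have "Q * qnum Q d = q * (q ^ d * r d)"
    unfolding qnum_rquantum[symmetric] by (simp add: power2_eq_square)
  then show "off_coeff l E = - q * r d / r (Suc d)"
    using E d q_nz nz by (simp add: off_coeff_def qnum_Suc_rquantum)
qed

lemma block_fixed:
  assumes "\<not> swappable l D" "ballot D n" "Suc l < n"
  shows "diag_coeff l D * cnj (diag_coeff l D) = 1" "off_coeff l D = 0"
proof -
  have "Q * (cnj q)\<^sup>2 = 1" using unit_times_cnj[OF cmod_q_power[of 2]] by simp
  then show "diag_coeff l D * cnj (diag_coeff l D) = 1" "off_coeff l D = 0"
    using ballot_height_pos[OF assms(2,3)] assms(1) by (auto simp: diag_coeff_def off_coeff_def swappable_def)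
qed

text \<open>With \<open>R\<^sub>i = [[d+i]]\<^sub>q\<close>, unitarity of the block comes down to \<open>R\<^sub>1\<^sup>2 = 1 + R\<^sub>0 R\<^sub>2\<close> and to the ratio
  \<open>N\<^sub>D R\<^sub>0 = N\<^sub>E R\<^sub>2\<close> of the norms.\<close>
lemma block_unitary_up_down:
  assumes "swappable l D" "Suc l < n" "Suc (Suc l) \<in> D"
  defines "E \<equiv> swap_step (Suc l) D" and "N \<equiv> \<lambda>D. complex_of_real (path_norm q D n)"
  shows "diag_coeff l D * cnj (diag_coeff l D) * N D + off_coeff l D * cnj (off_coeff l D) * N E = N D"
    "diag_coeff l E * cnj (diag_coeff l E) * N E + off_coeff l E * cnj (off_coeff l E) * N D = N E"
    "diag_coeff l D * cnj (off_coeff l E) * N D + off_coeff l D * cnj (diag_coeff l E) * N E = 0"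
    "diag_coeff l E * cnj (off_coeff l D) * N E + off_coeff l E * cnj (diag_coeff l D) * N D = 0"
proof -
  define d where "d = height D l"
  note v = up_down_coeffs[OF assms(1,3), folded d_def E_def]
  have nz: "r (Suc d) \<noteq> 0" by (simp add: r_nz)
  have N: "N D * r d = N E * r (Suc (Suc d))"
    using arg_cong[where f = complex_of_real, OF path_norm_swap_step[OF assms(1,3,2), of q]] unfolding N_def E_def d_def
    by (simp only: of_real_mult)
  have "complex_of_real ((r (Suc d))\<^sup>2) = of_real (1 + r d * r (Suc (Suc d)))"
    by (simp only: r_square)
  note r_sq_complex = this
  define R0 R1 R2 where "R0 = complex_of_real (r d)" and "R1 = complex_of_real (r (Suc d))"
    and "R2 = complex_of_real (r (Suc (Suc d)))"
  note v = v[folded R0_def R1_def R2_def]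
  have R1: "R1 \<noteq> 0" using nz by (simp add: R1_def)
  have cnj_R: "cnj R0 = R0" "cnj R1 = R1" "cnj R2 = R2" by (simp_all add: R0_def R1_def R2_def)
  have sq: "R1 * R1 = 1 + R0 * R2"
    using r_sq_complex by (simp add: power2_eq_square R0_def R1_def R2_def)
  have N: "N D * R0 = N E * R2" using N by (simp only: R0_def R2_def)
  have "diag_coeff l D * cnj (diag_coeff l D) = 1 / (R1 * R1)"
    "off_coeff l D * cnj (off_coeff l D) = R2 * R2 / (R1 * R1)"
    "diag_coeff l E * cnj (diag_coeff l E) = 1 / (R1 * R1)"
    "off_coeff l E * cnj (off_coeff l E) = R0 * R0 / (R1 * R1)"
    and mv: "diag_coeff l D * cnj (off_coeff l E) = inverse (q ^ Suc d) * R0 / (R1 * R1)"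
    "off_coeff l D * cnj (diag_coeff l E) = - inverse (q ^ Suc d) * R2 / (R1 * R1)"
    using R1 q_nz unfolding v by (simp_all add: cnj_q cnj_R field_simps)
  note sv = this(1-4)
  have "N D + R2 * R2 * N E = R1 * R1 * N D" "N E + R0 * R0 * N D = R1 * R1 * N E"
    unfolding sq using N by algebra+
  then show "diag_coeff l D * cnj (diag_coeff l D) * N D + off_coeff l D * cnj (off_coeff l D) * N E = N D"
    "diag_coeff l E * cnj (diag_coeff l E) * N E + off_coeff l E * cnj (off_coeff l E) * N D = N E"
    unfolding sv using R1 by (simp_all add: field_simps)
  have "diag_coeff l D * cnj (off_coeff l E) * N D + off_coeff l D * cnj (diag_coeff l E) * N E =
    inverse (q ^ Suc d) / (R1 * R1) * (N D * R0 - N E * R2)"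
    unfolding mv by (simp add: algebra_simps diff_divide_distrib)
  then show 3: "diag_coeff l D * cnj (off_coeff l E) * N D + off_coeff l D * cnj (diag_coeff l E) * N E = 0"
    unfolding N by simp
  have "cnj (diag_coeff l D * cnj (off_coeff l E) * N D + off_coeff l D * cnj (diag_coeff l E) * N E) = 0"
    unfolding 3 by simp
  then show "diag_coeff l E * cnj (off_coeff l D) * N E + off_coeff l E * cnj (diag_coeff l D) * N D = 0"
    by (simp add: N_def algebra_simps)
qed

text \<open>The relations which say that the block of \<open>T\<^bsub>l+1\<^esub>\<close> on the vectors of \<open>D\<close> and of its partner is unitary for the
  diagonal form with entries \<^const>\<open>path_norm\<close>.\<close>
lemma block_unitary:
  assumes "swappable l D" "Suc l < n"
  defines "E \<equiv> partner l D" and "N \<equiv> \<lambda>D. complex_of_real (path_norm q D n)"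
  shows "diag_coeff l D * cnj (diag_coeff l D) * N D + off_coeff l D * cnj (off_coeff l D) * N E = N D"
    "diag_coeff l D * cnj (off_coeff l E) * N D + off_coeff l D * cnj (diag_coeff l E) * N E = 0"
proof -
  have "diag_coeff l D * cnj (diag_coeff l D) * N D + off_coeff l D * cnj (off_coeff l D) * N E = N D \<and>
    diag_coeff l D * cnj (off_coeff l E) * N D + off_coeff l D * cnj (diag_coeff l E) * N E = 0"
  proof (cases "Suc (Suc l) \<in> D")
    case True
    then show ?thesis
      using block_unitary_up_down[OF assms(1,2)] assms(1) by (simp add: E_def N_def partner_def)
  next
    case False
    have "swappable l (swap_step (Suc l) D)" "Suc (Suc l) \<in> swap_step (Suc l) D"
      using assms(1) False by (auto simp: mem_swap_step swappable_def height_swap_step)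
    from block_unitary_up_down[OF this(1) assms(2) this(2)] show ?thesis
      using assms(1) by (simp add: E_def N_def partner_def swap_step_involutive)
  qed
  then show "diag_coeff l D * cnj (diag_coeff l D) * N D + off_coeff l D * cnj (off_coeff l D) * N E = N D"
    "diag_coeff l D * cnj (off_coeff l E) * N D + off_coeff l D * cnj (diag_coeff l E) * N E = 0" by blast+
qed

lemma partner_ne: "swappable l D \<Longrightarrow> partner l D \<noteq> D"
proof -
  assume "swappable l D"
  moreover have "Suc l \<in> swap_step (Suc l) D \<longleftrightarrow> Suc (Suc l) \<in> D" unfolding mem_swap_step by simp
  ultimately show ?thesis unfolding partner_def swappable_def by auto
qed

section \<open>Jucys--Murphy elements\<close>

text \<open>The multiplicative Jucys--Murphy element \<open>T\<^sub>k \<cdots> T\<^sub>1 T\<^sub>1 \<cdots> T\<^sub>k\<close> of the entry \<open>k + 1\<close>.\<close>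
primrec jucys_murphy :: "nat \<Rightarrow> tabvec \<Rightarrow> tabvec" where
  "jucys_murphy 0 f = f"
| "jucys_murphy (Suc k) f = hecke_T Q (Suc k) (jucys_murphy k (hecke_T Q (Suc k) f))"

lemma jucys_murphy_add: "jucys_murphy k (f + g) = jucys_murphy k f + jucys_murphy k g"
  by (induction k arbitrary: f g) (simp_all only: jucys_murphy.simps hecke_T_add)

lemma jucys_murphy_scale: "jucys_murphy k (cscale c f) = cscale c (jucys_murphy k f)"
  by (induction k arbitrary: f) (simp_all only: jucys_murphy.simps hecke_T_scale)

text \<open>The exponent is \<open>k\<close> plus the content (column minus row) of the entry \<open>k + 1\<close>, which is \<open>b - 1\<close> in the second row
  and \<open>k - b\<close> in the first row, where \<open>b\<close> is the number of earlier down steps. The truncated subtraction of 1 is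
  harmless, as the first step of a ballot path goes up.\<close>
definition jm_eigenvalue :: "nat \<Rightarrow> nat set \<Rightarrow> complex" where
  "jm_eigenvalue k D = (if Suc k \<in> D then Q ^ (k + downs D k - 1) else Q ^ (k + (k - downs D k)))"

lemma jm_eigenvalue_swap_step:
  assumes "ballot D l"
  shows "jm_eigenvalue l (swap_step (Suc l) D) = (if Suc (Suc l) \<in> D then Q ^ (l + downs D l - 1) else Q ^ (l + (l - downs D l)))"
proof -
  have int: "swap_step (Suc l) D \<inter> {1..l} = D \<inter> {1..l}" by (rule swap_step_Int_below) simp
  show ?thesis by (simp add: jm_eigenvalue_def downs_cong[OF int] mem_swap_step)
qed

text \<open>The diagonal matrix of one Jucys--Murphy element, multiplied on both sides by the matrix of a generator, gives
  the diagonal matrix of the next one.\<close>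
lemma jm_eigenvalue_step:
  assumes "ballot D n" "Suc l < n"
  shows "diag_coeff l D * jm_eigenvalue l D * off_coeff l D + off_coeff l D * jm_eigenvalue l (partner l D) * diag_coeff l (partner l D) = 0"
    "(diag_coeff l D)\<^sup>2 * jm_eigenvalue l D + off_coeff l D * jm_eigenvalue l (partner l D) * off_coeff l (partner l D) = jm_eigenvalue (Suc l) D"
proof -
  define d b where "d = height D l" and "b = downs D l"
  have bal: "ballot D l" using assms ballot_mono by (metis Suc_lessD less_imp_le)
  have l: "l = d + 2 * b" using height_downs[OF bal] by (simp add: d_def b_def)
  consider "Suc l \<in> D" "Suc (Suc l) \<in> D" | "Suc l \<notin> D" "Suc (Suc l) \<notin> D"
    | "Suc l \<notin> D" "Suc (Suc l) \<in> D" "height D l = 0"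
    | "Suc l \<notin> D" "Suc (Suc l) \<in> D" "0 < height D l" | "Suc l \<in> D" "Suc (Suc l) \<notin> D" "0 < height D l"
    using ballot_height_pos[OF assms]
    by (cases "Suc l \<in> D"; cases "Suc (Suc l) \<in> D"; cases "height D l = 0") auto
  then have "diag_coeff l D * jm_eigenvalue l D * off_coeff l D + off_coeff l D * jm_eigenvalue l (partner l D) * diag_coeff l (partner l D) = 0 \<and>
    (diag_coeff l D)\<^sup>2 * jm_eigenvalue l D + off_coeff l D * jm_eigenvalue l (partner l D) * off_coeff l (partner l D) = jm_eigenvalue (Suc l) D"
  proof cases
    case 1
    have "0 < d" using ballot_height_pos[OF assms 1(1)] by (simp add: d_def)
    then have "Suc (Suc (l + b - 1)) = Suc l + Suc b - 1" using l by simp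
    then have "Q ^ (Suc l + Suc b - 1) = Q\<^sup>2 * Q ^ (l + b - 1)" by (metis power_Suc power2_eq_square mult.assoc)
    with 1 show ?thesis by (simp add: diag_coeff_def off_coeff_def swappable_def jm_eigenvalue_def b_def)
  next
    case 2
    have "Suc l + (Suc l - b) = Suc (Suc (l + (l - b)))" using l by simp
    then have "Q ^ (Suc l + (Suc l - b)) = Q\<^sup>2 * Q ^ (l + (l - b))" by (metis power_Suc power2_eq_square mult.assoc)
    with 2 show ?thesis by (simp add: diag_coeff_def off_coeff_def swappable_def jm_eigenvalue_def b_def)
  next
    case 3
    then have "d = 0" by (simp only: d_def)
    then have "l - b = b" using l by simp
    with 3 show ?thesis by (simp add: diag_coeff_def off_coeff_def swappable_def jm_eigenvalue_def b_def)
  next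
    case 4
    then have d0: "0 < d" by (simp only: d_def)
    from 4 have swap_step: "swappable l D" by (simp add: swappable_def)
    define c where "c = qnum Q (Suc d)"
    have c: "c \<noteq> 0" by (simp add: c_def qnum_nz)
    \<comment> \<open>the exponents of the two eigenvalues differ by \<open>d + 1\<close>\<close>
    obtain e where e: "l + b - 1 = e" "Suc e = l + b" "l + (l - b) = Suc d + e"
      using l d0 by (intro that[of "l + b - 1"]) simp_all
    have Qd: "Q ^ d = c - qnum Q d" "Q * qnum Q d = c - 1"
      by (simp_all add: c_def qnum_Suc' ) (simp add: qnum_Suc qnum_Suc'[symmetric])
    have pd: "partner l D = swap_step (Suc l) D" using swap_step by (simp add: partner_def)
    have v: "diag_coeff l D = - 1 / c" "off_coeff l D = - ((1 + Q * c) / c)"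
      "diag_coeff l (partner l D) = Q * Q ^ d / c" "off_coeff l (partner l D) = - (Q * qnum Q d / c)"
      using 4 swap_step unfolding pd
      by (simp_all add: diag_coeff_def off_coeff_def swappable_swap_step height_swap_step mem_swap_step c_def[symmetric] d_def[symmetric]
        qnum_Suc[of Q "Suc d"] inverse_eq_divide)
    have ups: "Q ^ (l + (l - b)) = Q * Q ^ d * Q ^ e" unfolding e(3) by (simp add: power_add)
    have "jm_eigenvalue l D = Q ^ (l + (l - b))" using 4 by (simp add: jm_eigenvalue_def b_def)
    moreover have "jm_eigenvalue l (partner l D) = Q ^ (l + b - 1)"
      unfolding pd jm_eigenvalue_swap_step[OF bal] using 4 by (simp add: b_def)
    moreover have "jm_eigenvalue (Suc l) D = Q ^ Suc e" unfolding e(2) using 4 by (simp add: jm_eigenvalue_def b_def)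
    ultimately have t: "jm_eigenvalue l D = Q * Q ^ d * Q ^ e" "jm_eigenvalue l (partner l D) = Q ^ e" "jm_eigenvalue (Suc l) D = Q * Q ^ e"
      unfolding ups e(1) by (simp_all only: power_Suc ups)
    have P: "Q * Q ^ d = Q * c - c + 1" unfolding Qd(1) right_diff_distrib Qd(2) by simp
    show ?thesis unfolding v t P Qd(2) power2_eq_square[of "_ / c"] using c by (simp add: field_simps)
  next
    case 5
    then have d0: "0 < d" by (simp only: d_def)
    from 5 have swap_step: "swappable l D" by (simp add: swappable_def)
    define c where "c = qnum Q (Suc d)"
    have c: "c \<noteq> 0" by (simp add: c_def qnum_nz)
    obtain e where e: "l + b - 1 = e" "Suc e = l + b" "l + (l - b) = Suc d + e"
      using l d0 by (intro that[of "l + b - 1"]) simp_all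
    have Qd: "Q ^ d = c - qnum Q d" "Q * qnum Q d = c - 1"
      by (simp_all add: c_def qnum_Suc' ) (simp add: qnum_Suc qnum_Suc'[symmetric])
    have pd: "partner l D = swap_step (Suc l) D" using swap_step by (simp add: partner_def)
    have v: "diag_coeff l D = Q * Q ^ d / c" "off_coeff l D = - (Q * qnum Q d / c)"
      "diag_coeff l (partner l D) = - 1 / c" "off_coeff l (partner l D) = - ((1 + Q * c) / c)"
      using 5 swap_step unfolding pd
      by (simp_all add: diag_coeff_def off_coeff_def swappable_swap_step height_swap_step mem_swap_step c_def[symmetric] d_def[symmetric]
        qnum_Suc[of Q "Suc d"] inverse_eq_divide)
    have ups: "Q ^ (l + (l - b)) = Q * Q ^ d * Q ^ e" unfolding e(3) by (simp add: power_add)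
    have "jm_eigenvalue l D = Q ^ (l + b - 1)" using 5 by (simp add: jm_eigenvalue_def b_def)
    moreover have "jm_eigenvalue l (partner l D) = Q ^ (l + (l - b))"
      unfolding pd jm_eigenvalue_swap_step[OF bal] using 5 by (simp add: b_def)
    moreover have "jm_eigenvalue (Suc l) D = Q ^ Suc (l + (l - b))" using 5 by (simp add: jm_eigenvalue_def b_def)
    ultimately have t: "jm_eigenvalue l D = Q ^ e" "jm_eigenvalue l (partner l D) = Q * Q ^ d * Q ^ e" "jm_eigenvalue (Suc l) D = Q * (Q * Q ^ d * Q ^ e)"
      unfolding ups e(1) by (simp_all only: power_Suc ups)
    have P: "Q * Q ^ d = Q * c - c + 1" unfolding Qd(1) right_diff_distrib Qd(2) by simp
    show ?thesis unfolding v t P Qd(2) power2_eq_square[of "_ / c"] using c by (simp add: field_simps)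
  qed
  then show "diag_coeff l D * jm_eigenvalue l D * off_coeff l D + off_coeff l D * jm_eigenvalue l (partner l D) * diag_coeff l (partner l D) = 0"
    "(diag_coeff l D)\<^sup>2 * jm_eigenvalue l D + off_coeff l D * jm_eigenvalue l (partner l D) * off_coeff l (partner l D) = jm_eigenvalue (Suc l) D" by blast+
qed

lemma jucys_murphy_seminormal:
  assumes "k < n" "ballot D n"
  shows "jucys_murphy k (seminormal Q D n j) = cscale (jm_eigenvalue k D) (seminormal Q D n j)"
  using assms
proof (induction k arbitrary: D)
  case 0
  then have "1 \<notin> D" using ballot_mono[of D n 1] by auto
  then show ?case by (simp add: jm_eigenvalue_def)
next
  case (Suc k)
  let ?x = "seminormal Q D n j" and ?E = "partner k D"
  let ?y = "seminormal Q ?E n j"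
  note T = hecke_T_seminormal[OF _ Suc.prems(1)]
  have bal: "ballot ?E n" using Suc.prems ballot_partner by blast
  have "jucys_murphy (Suc k) ?x = hecke_T Q (Suc k) (cscale (diag_coeff k D) (jucys_murphy k ?x) + cscale (off_coeff k D) (jucys_murphy k ?y))"
    by (simp only: jucys_murphy.simps T[OF Suc.prems(2)] jucys_murphy_add jucys_murphy_scale)
  also have "\<dots> = cscale (diag_coeff k D * jm_eigenvalue k D) (hecke_T Q (Suc k) ?x) +
      cscale (off_coeff k D * jm_eigenvalue k ?E) (hecke_T Q (Suc k) ?y)"
    using Suc.IH[of D] Suc.IH[of ?E] Suc.prems bal
    by (simp only: hecke_T_add hecke_T_scale cvs.scale_scale Suc_lessD)
  also have "\<dots> = cscale ((diag_coeff k D)\<^sup>2 * jm_eigenvalue k D + off_coeff k D * jm_eigenvalue k ?E * off_coeff k ?E) ?x +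
     cscale (diag_coeff k D * jm_eigenvalue k D * off_coeff k D + off_coeff k D * jm_eigenvalue k ?E * diag_coeff k ?E) ?y"
    unfolding T[OF Suc.prems(2)] T[OF bal] partner_partner
    by (simp add: cscale_def fun_eq_iff algebra_simps power2_eq_square)
  also have "\<dots> = cscale (jm_eigenvalue (Suc k) D) ?x"
    unfolding jm_eigenvalue_step[OF Suc.prems(2,1)] by simp
  finally show ?case .
qed

lemma jm_eigenvalue_unit: "cmod (jm_eigenvalue k D) = 1"
  by (simp add: jm_eigenvalue_def norm_power norm_q)

lemma Q_power_inj: "Q ^ a = Q ^ b \<Longrightarrow> a = b"
proof (induction a b rule: linorder_wlog)
  case (le a b)
  have "Q ^ a * Q ^ (b - a) = Q ^ b" using le(1) by (simp only: power_add[symmetric] le_add_diff_inverse)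
  then have "Q ^ a * Q ^ (b - a) = Q ^ a * 1" using le(2) by (simp only: mult_1_right)
  then have "Q ^ (b - a) = 1" using q_nz by simp
  then show ?case using Q_power_ne_1[of "b - a"] le by (cases "b = a") auto
next
  case (sym a b)
  then show ?case by simp
qed

text \<open>At the first step where two paths differ, one content is \<open>b - 1\<close> and the other one is at least \<open>b\<close>.\<close>
lemma jm_eigenvalue_separates:
  assumes "D \<subseteq> {1..n}" "E \<subseteq> {1..n}" "ballot D n" "ballot E n" "D \<noteq> E"
  obtains k where "k < n" "jm_eigenvalue k D \<noteq> jm_eigenvalue k E"
proof -
  define k where "k = (LEAST k. (Suc k \<in> D) \<noteq> (Suc k \<in> E))"
  obtain p where p: "(p \<in> D) \<noteq> (p \<in> E)" using assms(5) by blast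
  then have "p \<in> {1..n}" using assms by blast
  then obtain p' where p': "p = Suc p'" using not0_implies_Suc by fastforce
  have k: "(Suc k \<in> D) \<noteq> (Suc k \<in> E)" unfolding k_def by (rule LeastI[of _ p']) (use p p' in simp)
  have kn: "k < n" using k assms(1,2) by (auto simp: subset_iff)
  have less: "(Suc j \<in> D) = (Suc j \<in> E)" if "j < k" for j using not_less_Least that unfolding k_def by blast
  have "D \<inter> {1..k} = E \<inter> {1..k}"
  proof -
    have "p \<in> D \<longleftrightarrow> p \<in> E" if "p \<in> {1..k}" for p
      using less[of "p - 1"] that by auto
    then show ?thesis by blast
  qed
  then have b: "downs D k = downs E k" by (rule downs_cong)
  have "ballot D k" using assms(3) kn ballot_mono by simp
  then have le: "2 * downs E k \<le> k" using height_downs[of D k] b by simp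
  have pos: "0 < k"
  proof (rule ccontr)
    assume "\<not> 0 < k"
    then have "1 \<in> D \<or> 1 \<in> E" "0 < n" using k kn by auto
    then show False using ballot_mono[OF assms(3), of 1] ballot_mono[OF assms(4), of 1] by auto
  qed
  have "k + downs E k - 1 \<noteq> k + (k - downs E k)" using le pos by linarith
  then have "jm_eigenvalue k D \<noteq> jm_eigenvalue k E" using k b Q_power_inj by (auto simp: jm_eigenvalue_def)
  with kn that show thesis by blast
qed

end

section \<open>Two-row paths as increasing sequences\<close>

text \<open>The ballot paths with \<open>n\<close> steps, \<open>m\<close> of them down: the standard tableaux of shape \<open>(n-m, m)\<close>, given by the entries
  of the second row.\<close>
definition two_row_paths :: "nat \<Rightarrow> nat \<Rightarrow> nat set set" where
  "two_row_paths n m = {D. D \<subseteq> {1..n} \<and> card D = m \<and> ballot D n}"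

text \<open>The path that starts with \<open>m\<close> up--down pairs and then only goes up.\<close>
definition zigzag :: "nat \<Rightarrow> nat set" where
  "zigzag m = (\<lambda>i. 2 * i) ` {1..m}"

text \<open>The second rows of standard tableaux of shape \<open>(n-m, m)\<close> as increasing sequences.\<close>
definition ballot_seqs :: "nat \<Rightarrow> nat \<Rightarrow> (nat \<Rightarrow> nat) set" where
  "ballot_seqs n m = {j \<in> {1..m} \<rightarrow>\<^sub>E {1..n}. strict_mono_on {1..m} j \<and> (\<forall>i\<in>{1..m}. 2 * i \<le> j i)}"

lemma ballot_iff: "ballot D n \<longleftrightarrow> (\<forall>p\<in>D \<inter> {1..n}. 2 * downs D p \<le> p)"
proof (induction n)
  case (Suc n)
  have "0 < height D n \<longleftrightarrow> 2 * downs D (Suc n) \<le> Suc n" if "ballot D n" "Suc n \<in> D"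
    using height_downs[OF that(1)] that(2) by auto
  then show ?case using Suc by (auto simp: atLeastAtMostSuc_conv)
qed simp

lemma downs_mono: "k \<le> n \<Longrightarrow> downs D k \<le> downs D n"
  unfolding downs_card by (intro card_mono) auto

lemma downs_image:
  assumes "strict_mono_on {1..m} j" "\<forall>i\<in>{1..m}. 1 \<le> j i" "i \<in> {1..m}"
  shows "downs (j ` {1..m}) (j i) = i" "downs (j ` {1..m}) (j i - 1) = i - 1"
proof -
  have less: "j a < j b \<longleftrightarrow> a < b" if "a \<in> {1..m}" "b \<in> {1..m}" for a b
    using strict_mono_on_less[OF assms(1)] that by blast
  have inj: "inj_on j {1..m}" using assms(1) by (rule strict_mono_on_imp_inj_on)
  have "j ` {1..m} \<inter> {1..j i} = j ` {1..i}"
    using assms(2,3) less by (force simp: not_less[symmetric])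
  moreover have "inj_on j {1..i}" by (rule inj_on_subset[OF inj]) (use assms(3) in auto)
  ultimately show "downs (j ` {1..m}) (j i) = i"
    unfolding downs_card by (simp add: card_image)
  have "j ` {1..m} \<inter> {1..j i - 1} = j ` {1..<i}"
  proof
    show "j ` {1..m} \<inter> {1..j i - 1} \<subseteq> j ` {1..<i}"
    proof
      fix p assume p: "p \<in> j ` {1..m} \<inter> {1..j i - 1}"
      then obtain a where a: "a \<in> {1..m}" "p = j a" by auto
      then have "a < i" using p less[OF a(1) assms(3)] assms(2,3) by fastforce
      then show "p \<in> j ` {1..<i}" using a by auto
    qed
    show "j ` {1..<i} \<subseteq> j ` {1..m} \<inter> {1..j i - 1}"
    proof
      fix p assume "p \<in> j ` {1..<i}"
      then obtain a where a: "a \<in> {1..<i}" "p = j a" by auto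
      then have "a \<in> {1..m}" using assms(3) by simp
      then show "p \<in> j ` {1..m} \<inter> {1..j i - 1}"
        using less[OF _ assms(3), of a] assms(2) a by fastforce
    qed
  qed
  moreover have "inj_on j {1..<i}" by (rule inj_on_subset[OF inj]) (use assms(3) in auto)
  ultimately show "downs (j ` {1..m}) (j i - 1) = i - 1"
    unfolding downs_card by (simp add: card_image)
qed

lemma ballot_seqsD:
  assumes "j \<in> ballot_seqs n m"
  shows "strict_mono_on {1..m} j" "\<forall>i\<in>{1..m}. 1 \<le> j i" "\<forall>i\<in>{1..m}. j i \<le> n"
    "\<forall>i\<in>{1..m}. 2 * i \<le> j i" "j \<in> extensional {1..m}" "inj_on j {1..m}"
  using assms strict_mono_on_imp_inj_on[of "{1..m}" j]
  unfolding ballot_seqs_def by (auto simp: PiE_iff)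

lemma bij_betw_ballot_seqs: "bij_betw (\<lambda>j. j ` {1..m}) (ballot_seqs n m) (two_row_paths n m)"
proof (rule bij_betw_imageI)
  show "inj_on (\<lambda>j. j ` {1..m}) (ballot_seqs n m)"
  proof (rule inj_onI)
    fix j k assume jk: "j \<in> ballot_seqs n m" "k \<in> ballot_seqs n m" "j ` {1..m} = k ` {1..m}"
    note j = ballot_seqsD[OF jk(1)] and k = ballot_seqsD[OF jk(2)]
    show "j = k"
    proof (rule extensionalityI[OF j(5) k(5)])
      fix i assume i: "i \<in> {1..m}"
      then obtain a where a: "a \<in> {1..m}" "j i = k a" using jk(3) by blast
      have "i = a" using downs_image(1)[OF j(1,2) i] downs_image(1)[OF k(1,2) a(1)] jk(3) a(2) by simp
      then show "j i = k i" using a by simp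
    qed
  qed
  show "(\<lambda>j. j ` {1..m}) ` ballot_seqs n m = two_row_paths n m"
  proof
    show "(\<lambda>j. j ` {1..m}) ` ballot_seqs n m \<subseteq> two_row_paths n m"
    proof
      fix D assume "D \<in> (\<lambda>j. j ` {1..m}) ` ballot_seqs n m"
      then obtain j where j: "j \<in> ballot_seqs n m" and D: "D = j ` {1..m}" by blast
      note jd = ballot_seqsD[OF j]
      have "2 * downs D p \<le> p" if "p \<in> D \<inter> {1..n}" for p
        using that downs_image(1)[OF jd(1,2)] jd(4) unfolding D by auto
      then have "ballot D n" unfolding ballot_iff by blast
      moreover have "card D = m" unfolding D using card_image[OF jd(6)] by simp
      moreover have "D \<subseteq> {1..n}" using jd(2,3) unfolding D by auto
      ultimately show "D \<in> two_row_paths n m" by (simp add: two_row_paths_def)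
    qed
    show "two_row_paths n m \<subseteq> (\<lambda>j. j ` {1..m}) ` ballot_seqs n m"
    proof
      fix D assume "D \<in> two_row_paths n m"
      then have D: "D \<subseteq> {1..n}" "card D = m" "ballot D n" by (simp_all add: two_row_paths_def)
      have fin: "finite D" using D(1) finite_subset by blast
      define L where "L = sorted_list_of_set D"
      have L: "sorted_wrt (<) L" "set L = D" "length L = m"
        using fin D(2) by (simp_all add: L_def)
      define j where "j = restrict (\<lambda>i. L ! (i - 1)) {1..m}"
      have mono: "strict_mono_on {1..m} j"
        unfolding strict_mono_on_def j_def using L(1,3) by (auto simp: sorted_wrt_nth_less)
      have img: "j ` {1..m} = D"
      proof -
        have "j ` {1..m} = (\<lambda>i. L ! (i - 1)) ` {1..m}" by (rule image_cong) (simp_all add: j_def)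
        also have "\<dots> = (!) L ` {0..<m}"
        proof
          show "(\<lambda>i. L ! (i - 1)) ` {1..m} \<subseteq> (!) L ` {0..<m}" by auto
          show "(!) L ` {0..<m} \<subseteq> (\<lambda>i. L ! (i - 1)) ` {1..m}"
          proof
            fix p assume "p \<in> (!) L ` {0..<m}"
            then obtain i where "i < m" "p = L ! i" by auto
            then show "p \<in> (\<lambda>i. L ! (i - 1)) ` {1..m}" by (intro image_eqI[of _ _ "Suc i"]) auto
          qed
        qed
        also have "\<dots> = D" using L(2,3) nth_image[of m L] by (simp add: atLeast0LessThan)
        finally show ?thesis .
      qed
      have range: "j i \<in> {1..n}" if "i \<in> {1..m}" for i using D(1) img that by blast
      have "2 * i \<le> j i" if i: "i \<in> {1..m}" for i
      proof -
        have "downs D (j i) = i" using downs_image(1)[OF mono _ i] range unfolding img by simp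
        moreover have "j i \<in> D \<inter> {1..n}" using range[OF i] img i by blast
        ultimately show ?thesis using D(3)[unfolded ballot_iff, rule_format, of "j i"] by simp
      qed
      then have "j \<in> ballot_seqs n m"
        using mono range by (auto simp: ballot_seqs_def j_def PiE_iff)
      then show "D \<in> (\<lambda>j. j ` {1..m}) ` ballot_seqs n m" using img by blast
    qed
  qed
qed

lemma finite_two_row_paths: "finite (two_row_paths n m)"
  by (rule finite_subset[of _ "Pow {1..n}"]) (auto simp: two_row_paths_def)

lemma zigzag_in_paths:
  assumes "2 * m \<le> n"
  shows "zigzag m \<in> two_row_paths n m"
proof -
  define j where "j = restrict (\<lambda>i. 2 * i) {1..m}"
  have "j \<in> ballot_seqs n m"
    using assms by (auto simp: ballot_seqs_def j_def strict_mono_on_def)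
  then have "j ` {1..m} \<in> two_row_paths n m"
    using bij_betw_ballot_seqs[of m n] by (auto simp: bij_betw_def)
  moreover have "j ` {1..m} = zigzag m" unfolding zigzag_def by (rule image_cong) (simp_all add: j_def)
  ultimately show ?thesis by simp
qed

context generic_unit
begin

lemma partner_in:
  assumes "D \<in> two_row_paths n m" "Suc l < n"
  shows "partner l D \<in> two_row_paths n m"
proof -
  have "swap_step (Suc l) D \<subseteq> {1..n}" if "D \<subseteq> {1..n}"
  proof
    fix p assume "p \<in> swap_step (Suc l) D"
    then have "transpose (Suc l) (Suc (Suc l)) p \<in> {1..n}" using that unfolding mem_swap_step by blast
    then show "p \<in> {1..n}" using assms(2) by (auto simp: transpose_def split: if_splits)
  qed
  moreover have "card (swap_step (Suc l) D) = card D" by (rule card_image) simp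
  ultimately show ?thesis
    using assms ballot_partner[of D n l] by (auto simp: two_row_paths_def partner_def)
qed

text \<open>Every other path contains an up--down pair at positive height: consider the first down step \<open>j\<^sub>i\<close> that is later
  than \<open>2i\<close>.\<close>
lemma exists_up_down:
  assumes "D \<in> two_row_paths n m" "D \<noteq> zigzag m"
  obtains l where "Suc l < n" "swappable l D" "Suc (Suc l) \<in> D"
proof -
  obtain j where j: "j \<in> ballot_seqs n m" and D: "D = j ` {1..m}"
    using assms(1) unfolding bij_betw_imp_surj_on[OF bij_betw_ballot_seqs, symmetric] by blast
  note jd = ballot_seqsD[OF j]
  define i where "i = (LEAST i. i \<in> {1..m} \<and> j i \<noteq> 2 * i)"
  have ex: "\<exists>i. i \<in> {1..m} \<and> j i \<noteq> 2 * i"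
    using assms(2) unfolding D zigzag_def by (metis (mono_tags, lifting) image_cong)
  have i: "i \<in> {1..m}" "j i \<noteq> 2 * i" using LeastI_ex[OF ex] unfolding i_def by auto
  have less: "j a = 2 * a" if "a \<in> {1..m}" "a < i" for a
    using not_less_Least[of a "\<lambda>i. i \<in> {1..m} \<and> j i \<noteq> 2 * i"] that unfolding i_def by blast
  have gt: "2 * i < j i" using jd(4) i by (metis le_neq_implies_less)
  define l where "l = j i - 2"
  have l: "Suc (Suc l) = j i" "Suc l = j i - 1" using gt i by (auto simp: l_def)
  have "Suc (Suc l) \<in> D" unfolding l(1) D using i by blast
  moreover have "Suc l \<notin> D"
  proof
    assume "Suc l \<in> D"
    then obtain a where a: "a \<in> {1..m}" "j a = Suc l" unfolding D by auto
    then have "j a < j i" using l by simp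
    then have "a < i" using strict_mono_on_less[OF jd(1) a(1) i(1)] by blast
    then show False using less[OF a(1)] a(2) l gt by simp
  qed
  moreover have "0 < height D l"
  proof -
    have "l \<le> n" using l i jd(3) by (metis Suc_leD)
    moreover have "ballot D n" using assms(1) by (simp add: two_row_paths_def)
    ultimately have "ballot D l" using ballot_mono by blast
    from height_downs[OF this] have "height D l + 2 * downs D l = l" .
    moreover have "downs D l \<le> i - 1"
      using downs_mono[of l "j i - 1" D] downs_image(2)[OF jd(1,2) i(1)] l unfolding D by simp
    ultimately show ?thesis using gt l i by auto
  qed
  moreover have "Suc l < n" using l i jd(3) by (metis Suc_le_lessD)
  ultimately show thesis using that by (auto simp: swappable_def)
qed

text \<open>Every path is obtained from the zigzag path by replacing down--up pairs by up--down pairs. Each replacement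
  increases the sum of the positions of the down steps, and the two paths are linked by a nonzero matrix entry.\<close>
lemma path_induct:
  assumes "D \<in> two_row_paths n m" "R (zigzag m)"
    and step: "\<And>D l. D \<in> two_row_paths n m \<Longrightarrow> Suc l < n \<Longrightarrow> off_coeff l D \<noteq> 0 \<Longrightarrow> swappable l D \<Longrightarrow> R D \<Longrightarrow> R (partner l D)"
  shows "R D"
  using assms(1)
proof (induction "\<Sum>D" arbitrary: D rule: less_induct)
  case less
  show ?case
  proof (cases "D = zigzag m")
    case False
    then obtain l where l: "Suc l < n" "swappable l D" "Suc (Suc l) \<in> D"
      using exists_up_down less.prems by blast
    define E where "E = swap_step (Suc l) D"
    \<comment> \<open>undoing an up--down pair of \<open>D\<close> gives a smaller path \<open>E\<close> whose partner is \<open>D\<close>\<close>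
    have E: "E = partner l D" "partner l E = D" using l partner_partner by (simp_all add: E_def partner_def swappable_swap_step swap_step_involutive)
    have fin: "finite D" using less.prems finite_subset by (auto simp: two_row_paths_def)
    have "\<Sum>E = (\<Sum>p\<in>D. transpose (Suc l) (Suc (Suc l)) p)"
      unfolding E_def by (subst sum.reindex) simp_all
    also have "\<dots> < \<Sum>D"
      using l by (intro sum_strict_mono_ex1[OF fin]) (auto simp: transpose_def swappable_def intro!: bexI[of _ "Suc (Suc l)"])
    finally have "\<Sum>E < \<Sum>D" .
    moreover have EP: "E \<in> two_row_paths n m" using partner_in[OF less.prems l(1)] E by simp
    ultimately have "R E" using less.hyps by blast
    moreover have sE: "swappable l E" using l(2) by (simp add: E_def swappable_swap_step)
    moreover have "off_coeff l E \<noteq> 0"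
      using up_down_coeffs(4)[OF l(2,3)] q_nz l(2) by (simp add: E_def r_nz swappable_def)
    ultimately show ?thesis using step[OF EP l(1)] E by auto
  qed (use assms(2) in simp)
qed

end

section \<open>The generator of the Specht module\<close>

text \<open>For \<open>m \<le> n - m\<close> the column tableau of shape \<open>(n-m, m)\<close> has the entries \<open>2c - 1\<close> and \<open>2c\<close> in column \<open>c \<le> m\<close> and one entry in
  each later column. Its column stabilizer consists of the involutions that exchange \<open>2c - 1\<close> and \<open>2c\<close> for all \<open>c\<close> in
  a set \<open>S\<close>.\<close>
definition column_flip :: "nat set \<Rightarrow> nat \<Rightarrow> nat" where
  "column_flip S k = (if 0 < k \<and> Suc k div 2 \<in> S then (if odd k then Suc k else k - 1) else k)"

text \<open>The rows and columns of the column tableau of shape \<open>(n-m, m)\<close>, which is that of the zigzag path.\<close>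
definition zigzag_row :: "nat \<Rightarrow> nat \<Rightarrow> nat \<Rightarrow> nat" where
  "zigzag_row n m k = (if k \<in> {1..n} then if k \<le> 2 * m \<and> even k then 2 else 1 else 0)"

definition zigzag_col :: "nat \<Rightarrow> nat \<Rightarrow> nat" where
  "zigzag_col m k = (if k \<le> 2 * m then Suc k div 2 else k - m)"

lemma pair_position_cases:
  obtains "(k::nat) = 0" | a where "k = Suc (2 * a)" | a where "k = Suc (Suc (2 * a))"
proof (cases k)
  case (Suc l)
  then show thesis using that(2,3) by (cases "even l") (auto elim!: evenE oddE)
qed (use that(1) in simp)

lemma sum_list_two_parts: "(m::nat) \<le> n \<Longrightarrow> sum_list [n - m, m] = n" by simp

lemma column_boxes_two_row:
  assumes "2 * m \<le> n" "m \<le> n"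
  shows "column_boxes [n - m, m] =
    concat (map (\<lambda>c. [(1, c), (2, c)]) [1..<Suc m]) @ map (\<lambda>c. (1, c)) [Suc m..<Suc (n - m)]"
proof -
  let ?f = "\<lambda>c. map (\<lambda>r. (r, c)) [1..<Suc (conj_part [n - m, m] c)]"
  have "[1..<Suc (n - m)] = [1..<Suc m] @ [Suc m..<Suc (n - m)]"
    using upt_add_eq_append[of 1 "Suc m" "n - 2 * m"] assms by simp
  then have "column_boxes [n - m, m] = concat (map ?f [1..<Suc m]) @ concat (map ?f [Suc m..<Suc (n - m)])"
    unfolding column_boxes_def by simp
  moreover have "map ?f [1..<Suc m] = map (\<lambda>c. [(1, c), (2, c)]) [1..<Suc m]"
  proof (rule map_cong[OF refl])
    fix c assume "c \<in> set [1..<Suc m]"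
    then have "c \<le> m" "c \<le> n - m" using assms by auto
    then have "conj_part [n - m, m] c = 2" by (simp add: conj_part_def)
    moreover have "[1..<Suc 2] = [1, 2::nat]" by (simp add: numeral_2_eq_2)
    ultimately show "?f c = [(1, c), (2, c)]" by (simp only: list.map)
  qed
  moreover have "map ?f [Suc m..<Suc (n - m)] = map (\<lambda>c. [(1, c)]) [Suc m..<Suc (n - m)]"
    using assms by (intro map_cong) (auto simp: conj_part_def)
  moreover have "concat (map (\<lambda>c. [(1::nat, c)]) xs) = map (\<lambda>c. (1, c)) xs" for xs :: "nat list"
    by (induction xs) auto
  ultimately show ?thesis by (simp only:)
qed

lemma nth_column_pairs:
  "length (concat (map (\<lambda>c. [(1::nat, c), (2, c)]) [1..<Suc m])) = 2 * m"
  "k < 2 * m \<Longrightarrow> concat (map (\<lambda>c. [(1::nat, c), (2, c)]) [1..<Suc m]) ! k = (k mod 2 + 1, k div 2 + 1)"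
proof -
  show len: "length (concat (map (\<lambda>c. [(1::nat, c), (2, c)]) [1..<Suc m])) = 2 * m" for m
    by (induction m) simp_all
  show "k < 2 * m \<Longrightarrow> concat (map (\<lambda>c. [(1::nat, c), (2, c)]) [1..<Suc m]) ! k = (k mod 2 + 1, k div 2 + 1)"
  proof (induction m)
    case (Suc m)
    let ?L = "concat (map (\<lambda>c. [(1::nat, c), (2, c)]) [1..<Suc m])"
    have L: "concat (map (\<lambda>c. [(1::nat, c), (2, c)]) [1..<Suc (Suc m)]) = ?L @ [(1, Suc m), (2, Suc m)]"
      by simp
    have "k < 2 * m \<or> k = 2 * m \<or> k = Suc (2 * m)" using Suc.prems by auto
    then consider "k < 2 * m" | "k = 2 * m" | "k = Suc (2 * m)" by blast
    then show ?case
    proof cases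
      case 1
      then show ?thesis unfolding L nth_append len using Suc.IH by simp
    qed (unfold L nth_append len, simp_all)
  qed simp
qed

lemma column_tableau_two_row:
  assumes "2 * m \<le> n"
  shows "column_tableau_row [n - m, m] = zigzag_row n m"
    "k \<in> {1..n} \<Longrightarrow> column_tableau_col [n - m, m] k = zigzag_col m k"
proof -
  have mn: "m \<le> n" using assms by simp
  have box: "column_boxes [n - m, m] ! (k - 1) = (zigzag_row n m k, zigzag_col m k)" if k: "k \<in> {1..n}" for k
  proof (cases "k \<le> 2 * m")
    case True
    then have "k - 1 < 2 * m" using k by (cases k) auto
    then have "column_boxes [n - m, m] ! (k - 1) = ((k - 1) mod 2 + 1, (k - 1) div 2 + 1)"
      unfolding column_boxes_two_row[OF assms mn] nth_append nth_column_pairs(1) by (simp only: if_True nth_column_pairs(2))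
    also have "\<dots> = (zigzag_row n m k, zigzag_col m k)"
      using True k by (cases k rule: pair_position_cases) (auto simp: zigzag_row_def zigzag_col_def)
    finally show ?thesis .
  next
    case False
    then have "\<not> k - 1 < 2 * m" "k - 1 - 2 * m < Suc (n - m) - Suc m" using k by auto
    then have "column_boxes [n - m, m] ! (k - 1) = (1, Suc m + (k - 1 - 2 * m))"
      unfolding column_boxes_two_row[OF assms mn] nth_append nth_column_pairs(1)
      by (simp only: if_False nth_map length_upt nth_upt)
    also have "\<dots> = (zigzag_row n m k, zigzag_col m k)"
      using False k by (auto simp: zigzag_row_def zigzag_col_def)
    finally show ?thesis .
  qed
  show "column_tableau_row [n - m, m] = zigzag_row n m"
    unfolding column_tableau_row_def sum_list_two_parts[OF mn] fun_eq_iff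
    using box by (auto simp: zigzag_row_def)
  show "k \<in> {1..n} \<Longrightarrow> column_tableau_col [n - m, m] k = zigzag_col m k"
    unfolding column_tableau_col_def sum_list_two_parts[OF mn] using box by simp
qed

lemma column_flip_simps:
  "column_flip S 0 = 0"
  "column_flip S (Suc (2 * a)) = (if Suc a \<in> S then Suc (Suc (2 * a)) else Suc (2 * a))"
  "column_flip S (Suc (Suc (2 * a))) = (if Suc a \<in> S then Suc (2 * a) else Suc (Suc (2 * a)))"
  by (simp_all add: column_flip_def)

lemma column_flip_involutive: "column_flip S (column_flip S k) = k"
  by (cases k rule: pair_position_cases) (simp_all add: column_flip_simps)

lemma Suc_column_flip_div: "Suc (column_flip S k) div 2 = Suc k div 2"
  by (cases k rule: pair_position_cases) (simp_all add: column_flip_simps)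

lemma column_flip_range:
  assumes "S \<subseteq> {1..m}" "2 * m \<le> n" "k \<in> {1..n}"
  shows "column_flip S k \<in> {1..n}"
  using assms by (cases k rule: pair_position_cases) (auto simp: column_flip_simps)

lemma column_flip_permutes:
  assumes "S \<subseteq> {1..m}" "2 * m \<le> n"
  shows "column_flip S permutes {1..n}"
proof (rule bij_imp_permutes)
  show "bij_betw (column_flip S) {1..n} {1..n}"
    by (rule bij_betw_byWitness[of _ "column_flip S"]) (use column_flip_involutive column_flip_range[OF assms] in auto)
  fix k assume k: "k \<notin> {1..n}"
  show "column_flip S k = k"
  proof (cases "k = 0")
    case False
    then have "n < k" using k by auto
    then have "Suc k div 2 > m" using assms(2) by auto
    then have "Suc k div 2 \<notin> S" using assms(1) by auto
    then show ?thesis by (simp add: column_flip_def)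
  qed (simp add: column_flip_def)
qed

lemma inv_column_flip: "inv (column_flip S) = column_flip S"
  by (rule inv_unique_comp) (auto simp: fun_eq_iff column_flip_involutive)

lemma zigzag_col_flip: "S \<subseteq> {1..m} \<Longrightarrow> zigzag_col m (column_flip S k) = zigzag_col m k"
proof -
  assume S: "S \<subseteq> {1..m}"
  show ?thesis
  proof (cases "0 < k \<and> Suc k div 2 \<in> S")
    case True
    then have "Suc k div 2 \<le> m" using S by auto
    moreover from this have "Suc (column_flip S k) div 2 \<le> m" by (simp add: Suc_column_flip_div)
    ultimately show ?thesis using Suc_column_flip_div[of S k] unfolding zigzag_col_def by auto
  next
    case False
    then have "column_flip S k = k" unfolding column_flip_def by auto
    then show ?thesis by simp
  qed
qed

lemma column_flip_inj: "S \<subseteq> {1..m} \<Longrightarrow> S' \<subseteq> {1..m} \<Longrightarrow> column_flip S = column_flip S' \<Longrightarrow> S = S'"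
proof -
  have *: "c \<in> S \<longleftrightarrow> column_flip S (2 * c) \<noteq> 2 * c" if "S \<subseteq> {1..m}" for S c
    using that by (auto simp: column_flip_def subset_iff)
  assume "S \<subseteq> {1..m}" "S' \<subseteq> {1..m}" "column_flip S = column_flip S'"
  then show "S = S'" using *[of S] *[of S'] by auto
qed

lemma bij_betw_column_flip:
  assumes "2 * m \<le> n"
  shows "bij_betw column_flip (Pow {1..m}) (column_stabilizer [n - m, m])"
proof (rule bij_betw_imageI)
  have mn: "m \<le> n" using assms by simp
  have stab: "column_stabilizer [n - m, m] =
      {\<sigma>. \<sigma> permutes {1..n} \<and> (\<forall>k\<in>{1..n}. zigzag_col m (\<sigma> k) = zigzag_col m k)}"
    unfolding column_stabilizer_def sum_list_two_parts[OF mn]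
    using column_tableau_two_row(2)[OF assms] permutes_in_image[of _ "{1..n}"]
    by (intro Collect_cong conj_cong ball_cong refl) metis
  show "inj_on column_flip (Pow {1..m})" by (rule inj_onI) (use column_flip_inj in blast)
  show "column_flip ` Pow {1..m} = column_stabilizer [n - m, m]"
  proof
    show "column_flip ` Pow {1..m} \<subseteq> column_stabilizer [n - m, m]"
      unfolding stab using column_flip_permutes[OF _ assms] zigzag_col_flip by auto
    show "column_stabilizer [n - m, m] \<subseteq> column_flip ` Pow {1..m}"
    proof
      fix \<sigma> assume "\<sigma> \<in> column_stabilizer [n - m, m]"
      then have perm: "\<sigma> permutes {1..n}" and col: "\<And>k. k \<in> {1..n} \<Longrightarrow> zigzag_col m (\<sigma> k) = zigzag_col m k"
        unfolding stab by auto
      have inj: "\<sigma> a = \<sigma> b \<Longrightarrow> a = b" for a b using permutes_inj[OF perm] by (auto dest: injD)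
      define S where "S = {c \<in> {1..m}. \<sigma> (2 * c) \<noteq> 2 * c}"
      have "\<sigma> k = column_flip S k" for k
      proof (cases "k \<in> {1..n}")
        case False
        have "S \<subseteq> {1..m}" by (auto simp: S_def)
        then have "column_flip S k = k" using column_flip_permutes[OF _ assms] False by (meson permutes_not_in)
        then show ?thesis using permutes_not_in[OF perm False] by simp
      next
        case k: True
        show ?thesis
        proof (cases "k \<le> 2 * m")
          case False
          then have "Suc k div 2 \<notin> S" by (auto simp: S_def)
          moreover have "\<sigma> k = k" using col[OF k] False by (auto simp: zigzag_col_def split: if_splits)
          ultimately show ?thesis by (simp add: column_flip_def)
        next
          case True
          define c where "c = Suc k div 2"
          have c: "c \<in> {1..m}" "k = 2 * c \<or> Suc k = 2 * c" using True k by (auto simp: c_def)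
          have img: "\<sigma> p \<in> {2 * c - 1, 2 * c}" if "p \<in> {2 * c - 1, 2 * c}" for p
          proof -
            have p: "p \<in> {1..n}" "zigzag_col m p = c" using that c(1) assms by (auto simp: zigzag_col_def)
            then have "zigzag_col m (\<sigma> p) = c" using col by simp
            then have "Suc (\<sigma> p) div 2 = c" using c(1) by (auto simp: zigzag_col_def split: if_splits)
            then show ?thesis using c(1) by auto
          qed
          have "\<sigma> (2 * c - 1) \<noteq> \<sigma> (2 * c)" using inj[of "2 * c - 1" "2 * c"] c(1) by auto
          moreover obtain a where a: "c = Suc a" using c(1) by (cases c) auto
          ultimately have ne: "\<sigma> (Suc (2 * a)) \<noteq> \<sigma> (Suc (Suc (2 * a)))" by simp
          have im: "\<sigma> (Suc (2 * a)) \<in> {Suc (2 * a), Suc (Suc (2 * a))}"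
            "\<sigma> (Suc (Suc (2 * a))) \<in> {Suc (2 * a), Suc (Suc (2 * a))}"
            using img[of "Suc (2 * a)"] img[of "Suc (Suc (2 * a))"] by (simp_all add: a)
          have "Suc a \<in> S \<longleftrightarrow> \<sigma> (Suc (Suc (2 * a))) \<noteq> Suc (Suc (2 * a))"
            using c(1) by (simp add: S_def a)
          moreover have "k = Suc (2 * a) \<or> k = Suc (Suc (2 * a))" using c(2) a by auto
          ultimately show ?thesis using ne im by (elim disjE) (auto simp: column_flip_simps)
        qed
      qed
      then have "\<sigma> = column_flip S" by (rule ext)
      moreover have "S \<in> Pow {1..m}" by (auto simp: S_def)
      ultimately show "\<sigma> \<in> column_flip ` Pow {1..m}" by (rule image_eqI)
    qed
  qed
qed

lemma perm_length_column_flip: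
  assumes "S \<subseteq> {1..m}" "2 * m \<le> n"
  shows "perm_length n (column_flip S) = card S"
proof -
  have "{(i, j). 1 \<le> i \<and> i < j \<and> j \<le> n \<and> column_flip S j < column_flip S i} = (\<lambda>c. (2 * c - 1, 2 * c)) ` S"
    (is "?I = ?J")
  proof
    show "?I \<subseteq> ?J"
    proof clarify
      fix i j assume ij: "1 \<le> i" "i < j" "j \<le> n" "column_flip S j < column_flip S i"
      define c where "c = Suc i div 2"
      have "Suc i div 2 \<le> Suc j div 2" "Suc (column_flip S j) div 2 \<le> Suc (column_flip S i) div 2"
        using ij by (auto intro: div_le_mono)
      then have "Suc i div 2 = Suc j div 2" by (simp add: Suc_column_flip_div)
      then have cij: "i = 2 * c - 1" "j = 2 * c"
        using ij by (cases i rule: pair_position_cases; cases j rule: pair_position_cases; auto simp: c_def)+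
      then have "c \<in> S" using ij by (auto simp: column_flip_def c_def[symmetric] split: if_splits)
      then show "(i, j) \<in> ?J" using cij by blast
    qed
    show "?J \<subseteq> ?I"
      using assms by (fastforce simp: column_flip_def subset_iff)
  qed
  moreover have "inj_on (\<lambda>c. (2 * c - 1, 2 * c)) S" by (auto simp: inj_on_def)
  ultimately show ?thesis unfolding perm_length_def by (simp add: card_image)
qed

text \<open>The generator of the Specht module as a sum over the subsets of the columns of length 2.\<close>
definition zigzag_vec :: "complex \<Rightarrow> nat \<Rightarrow> nat \<Rightarrow> tabvec" where
  "zigzag_vec Q n m = (\<Sum>S\<in>Pow {1..m}. cscale (inverse (- Q) ^ card S) (tabloid_basis (zigzag_row n m \<circ> column_flip S)))"

lemma specht_generator_two_row:
  assumes "2 * m \<le> n"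
  shows "specht_generator Q [n - m, m] = zigzag_vec Q n m"
proof -
  have mn: "m \<le> n" using assms by simp
  show ?thesis
    unfolding specht_generator_def zigzag_vec_def sum_list_two_parts[OF mn] column_tableau_two_row(1)[OF assms]
    by (subst sum.reindex_bij_betw[OF bij_betw_column_flip[OF assms], symmetric])
       (auto intro!: sum.cong simp: perm_length_column_flip[OF _ assms] inv_column_flip)
qed

lemma append_tabloid:
  assumes "t p = 0" "a \<noteq> 0"
  shows "append_entry p a (tabloid_basis t) = tabloid_basis (t(p := a))"
proof
  fix w
  have "w p = a \<and> w(p := 0) = t \<longleftrightarrow> w = t(p := a)" using assms by (auto simp: fun_eq_iff)
  then show "append_entry p a (tabloid_basis t) w = tabloid_basis (t(p := a)) w"
    by (auto simp: append_entry_def tabloid_basis_def)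
qed

lemma column_flip_above: "S \<subseteq> {1..m} \<Longrightarrow> 2 * m < k \<Longrightarrow> column_flip S k = k"
  by (cases k rule: pair_position_cases) (auto simp: column_flip_simps)

lemma column_flip_insert:
  assumes "S \<subseteq> {1..m}"
  shows "k \<le> 2 * m \<Longrightarrow> column_flip (insert (Suc m) S) k = column_flip S k"
    "column_flip (insert (Suc m) S) (Suc (2 * m)) = Suc (Suc (2 * m))"
    "column_flip (insert (Suc m) S) (Suc (Suc (2 * m))) = Suc (2 * m)"
    "Suc (Suc (2 * m)) < k \<Longrightarrow> column_flip (insert (Suc m) S) k = k"
  using assms by (auto simp: column_flip_def subset_iff)

lemma column_flip_le: "S \<subseteq> {1..m} \<Longrightarrow> k \<le> 2 * m \<Longrightarrow> column_flip S k \<le> 2 * m"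
  using column_flip_range[of S m "2 * m" k] by (cases "k = 0") (auto simp: column_flip_def)

text \<open>In terms of tensors, this lemma and the next one say that the generator is the product of \<open>m\<close> factors
  \<open>e\<^sub>1 \<otimes> e\<^sub>2 - Q\<^bsup>-1\<^esup> e\<^sub>2 \<otimes> e\<^sub>1\<close> and \<open>n - 2m\<close> factors \<open>e\<^sub>1\<close>.\<close>
lemma zigzag_vec_Suc:
  assumes "2 * m \<le> n"
  shows "zigzag_vec Q (Suc n) m = append_entry (Suc n) 1 (zigzag_vec Q n m)"
proof -
  have "tabloid_basis (zigzag_row (Suc n) m \<circ> column_flip S) = append_entry (Suc n) 1 (tabloid_basis (zigzag_row n m \<circ> column_flip S))"
    if S: "S \<in> Pow {1..m}" for S
  proof -
    have f: "column_flip S (Suc n) = Suc n" using S assms by (intro column_flip_above[of _ m]) auto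
    have "zigzag_row (Suc n) m \<circ> column_flip S = (zigzag_row n m \<circ> column_flip S)(Suc n := 1)"
    proof
      fix k
      have "column_flip S k = Suc n \<longleftrightarrow> k = Suc n" using column_flip_involutive f by metis
      then show "(zigzag_row (Suc n) m \<circ> column_flip S) k = ((zigzag_row n m \<circ> column_flip S)(Suc n := 1)) k"
        using assms f by (auto simp: zigzag_row_def)
    qed
    then show ?thesis using f by (subst append_tabloid) (auto simp: zigzag_row_def)
  qed
  then show ?thesis
    unfolding zigzag_vec_def append_entry_sum append_entry_scale by (intro sum.cong) auto
qed

lemma zigzag_vec_pair:
  fixes Q m
  defines "E \<equiv> \<lambda>a b. append_entry (Suc (Suc (2 * m))) b (append_entry (Suc (2 * m)) a (zigzag_vec Q (2 * m) m))"
  shows "zigzag_vec Q (Suc (Suc (2 * m))) (Suc m) = E 1 2 + cscale (inverse (- Q)) (E 2 1)"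
proof -
  let ?n = "Suc (Suc (2 * m))"
  let ?t = "\<lambda>S. zigzag_row (2 * m) m \<circ> column_flip S" and ?t' = "\<lambda>S. zigzag_row ?n (Suc m) \<circ> column_flip S"
  have two: "tabloid_basis ((t(Suc (2 * m) := a))(?n := b)) =
      append_entry ?n b (append_entry (Suc (2 * m)) a (tabloid_basis t))"
    if "t (Suc (2 * m)) = 0" "t ?n = 0" "a \<noteq> 0" "b \<noteq> 0" for t a b
    using that append_tabloid[of t "Suc (2 * m)" a] append_tabloid[of "t(Suc (2 * m) := a)" ?n b] by simp
  have zero: "?t S (Suc (2 * m)) = 0" "?t S ?n = 0" if "S \<in> Pow {1..m}" for S
    using that column_flip_above[of S m] by (auto simp: zigzag_row_def)
  have low: "zigzag_row ?n (Suc m) p = zigzag_row (2 * m) m p" if "p \<le> 2 * m" for p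
    using that by (auto simp: zigzag_row_def)
  have a: "?t' S = (?t S)(Suc (2 * m) := 1, ?n := 2)" if "S \<in> Pow {1..m}" for S
  proof
    fix k
    have S: "S \<subseteq> {1..m}" using that by simp
    consider "k \<le> 2 * m" | "k = Suc (2 * m)" | "k = ?n" | "?n < k" by linarith
    then show "?t' S k = ((?t S)(Suc (2 * m) := 1, ?n := 2)) k"
      by cases (use low column_flip_le[OF S, of k] column_flip_above[OF S, of k] in \<open>auto simp: zigzag_row_def\<close>)
  qed
  have b: "?t' (insert (Suc m) S) = (?t S)(Suc (2 * m) := 2, ?n := 1)" if "S \<in> Pow {1..m}" for S
  proof
    fix k
    have S: "S \<subseteq> {1..m}" using that by simp
    consider "k \<le> 2 * m" | "k = Suc (2 * m)" | "k = ?n" | "?n < k" by linarith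
    then show "?t' (insert (Suc m) S) k = ((?t S)(Suc (2 * m) := 2, ?n := 1)) k"
      by cases (use low column_flip_le[OF S, of k] column_flip_above[OF S, of k] column_flip_insert[OF S] in \<open>auto simp: zigzag_row_def\<close>)
  qed
  have ta: "tabloid_basis (?t' S) = append_entry ?n 2 (append_entry (Suc (2 * m)) 1 (tabloid_basis (?t S)))"
    and tb: "tabloid_basis (?t' (insert (Suc m) S)) =
      append_entry ?n 1 (append_entry (Suc (2 * m)) 2 (tabloid_basis (?t S)))"
    if "S \<in> Pow {1..m}" for S
    unfolding a[OF that] b[OF that] using two zero[OF that] by simp_all
  have nin: "S \<in> Pow {1..m} \<Longrightarrow> Suc m \<notin> S \<and> finite S" for S
    using finite_subset[of S "{1..m}"] by auto
  have "Pow {1..Suc m} = Pow {1..m} \<union> insert (Suc m) ` Pow {1..m}"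
  proof -
    have "{1..Suc m} = insert (Suc m) {1..m}" by auto
    then show ?thesis by (simp only: Pow_insert)
  qed
  moreover have "Pow {1..m} \<inter> insert (Suc m) ` Pow {1..m} = {}" by auto
  moreover have "inj_on (insert (Suc m)) (Pow {1..m})"
    using nin by (intro inj_onI) (metis insert_ident)
  ultimately have "zigzag_vec Q ?n (Suc m) =
     (\<Sum>S\<in>Pow {1..m}. cscale (inverse (- Q) ^ card S) (tabloid_basis (?t' S))) +
     (\<Sum>S\<in>Pow {1..m}. cscale (inverse (- Q) ^ card (insert (Suc m) S)) (tabloid_basis (?t' (insert (Suc m) S))))"
    unfolding zigzag_vec_def by (simp only: sum.union_disjoint finite_imageI finite_Pow_iff finite_atLeastAtMost
      sum.reindex comp_def)
  also have "(\<Sum>S\<in>Pow {1..m}. cscale (inverse (- Q) ^ card S) (tabloid_basis (?t' S))) = E 1 2"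
    unfolding E_def zigzag_vec_def append_entry_sum append_entry_scale using ta by (intro sum.cong) simp_all
  also have "(\<Sum>S\<in>Pow {1..m}. cscale (inverse (- Q) ^ card (insert (Suc m) S)) (tabloid_basis (?t' (insert (Suc m) S)))) =
    cscale (inverse (- Q)) (E 2 1)"
    unfolding E_def zigzag_vec_def append_entry_sum append_entry_scale cvs.scale_sum_right
    using tb nin by (intro sum.cong) simp_all
  finally show ?thesis .
qed

lemma zigzag_Suc_Int: "zigzag (Suc m) \<inter> {1..2 * m} = zigzag m \<inter> {1..2 * m}"
  by (auto simp: zigzag_def)

lemma mem_zigzag: "p \<in> zigzag m \<longleftrightarrow> p \<in> {1..2 * m} \<and> even p"
  by (auto simp: zigzag_def elim!: evenE)

lemma seminormal_zigzag_even:
  assumes "Q \<noteq> 0"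
  shows "\<exists>c. c \<noteq> 0 \<and> seminormal Q (zigzag m) (2 * m) 0 = cscale c (zigzag_vec Q (2 * m) m)"
proof (induction m)
  case 0
  have "zigzag_row 0 0 \<circ> column_flip {} = (\<lambda>_. 0)" by (auto simp: zigzag_row_def)
  then have "zigzag_vec Q 0 0 = tabloid_basis (\<lambda>_. 0)" by (simp add: zigzag_vec_def)
  then show ?case by (intro exI[of _ 1]) simp
next
  case (Suc m)
  then obtain c where c: "c \<noteq> 0" "seminormal Q (zigzag m) (2 * m) 0 = cscale c (zigzag_vec Q (2 * m) m)" by blast
  let ?D = "zigzag (Suc m)"
  have D: "?D \<in> two_row_paths (2 * Suc m) (Suc m)" "zigzag m \<in> two_row_paths (2 * m) m"
    by (rule zigzag_in_paths, simp)+
  then have bal: "ballot (zigzag m) (2 * m)" by (simp add: two_row_paths_def)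
  have d: "downs ?D (2 * m) = m"
    using downs_cong[OF zigzag_Suc_Int] D(2) unfolding two_row_paths_def
    by (metis (mono_tags, lifting) downs_card inf.absorb1 mem_Collect_eq)
  then have h: "height ?D (2 * m) = 0"
    using height_downs[of ?D "2 * m"] bal ballot_cong[OF zigzag_Suc_Int] by simp
  have z: "seminormal Q ?D (2 * m) 1 = 0"
    using bal h by (intro seminormal_eq_0) (simp_all add: ballot_cong[OF zigzag_Suc_Int])
  have s: "seminormal Q ?D (2 * m) 0 = cscale c (zigzag_vec Q (2 * m) m)"
    using seminormal_cong[OF zigzag_Suc_Int] c(2) by simp
  have mem: "Suc (2 * m) \<notin> ?D" "Suc (Suc (2 * m)) \<in> ?D" by (auto simp: mem_zigzag)
  have "seminormal Q ?D (Suc (Suc (2 * m))) 0 = cscale (c * Q ^ Suc m) (zigzag_vec Q (Suc (Suc (2 * m))) (Suc m))"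
    using mem h d z s assms unfolding zigzag_vec_pair
    by (simp add: entry_linear_simps qnum_Suc) (simp add: cscale_def fun_eq_iff field_simps)
  then show ?case using c(1) assms by (intro exI[of _ "c * Q ^ Suc m"]) simp
qed

text \<open>The seminormal vector of the zigzag path spans the same line as the generator.\<close>
lemma seminormal_zigzag:
  assumes "Q \<noteq> 0" "2 * m \<le> n"
  shows "\<exists>c. c \<noteq> 0 \<and> seminormal Q (zigzag m) n 0 = cscale c (zigzag_vec Q n m)"
  using assms(2)
proof (induction n rule: dec_induct)
  case base
  show ?case by (rule seminormal_zigzag_even[OF assms(1)])
next
  case (step n)
  then obtain c where "c \<noteq> 0" "seminormal Q (zigzag m) n 0 = cscale c (zigzag_vec Q n m)" by blast
  moreover have "Suc n \<notin> zigzag m" using step by (simp add: mem_zigzag)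
  ultimately show ?case using step
    by (intro exI[of _ c]) (simp add: zigzag_vec_Suc append_entry_scale)
qed

section \<open>Signatures of Hermitian forms\<close>

lemma hermitian_sum:
  assumes B: "hermitian_form_on V B" and V: "cvs.subspace V"
    and "f ` S \<subseteq> V" "g ` T \<subseteq> V"
  shows "B (\<Sum>i\<in>S. cscale (a i) (f i)) (\<Sum>j\<in>T. cscale (b j) (g j)) =
    (\<Sum>i\<in>S. \<Sum>j\<in>T. a i * cnj (b j) * B (f i) (g j))"
proof -
  have add: "B (u + v) w = B u w + B v w" if "u \<in> V" "v \<in> V" "w \<in> V" for u v w
    using B that unfolding hermitian_form_on_def by blast
  have scale: "B (cscale c u) v = c * B u v" if "u \<in> V" "v \<in> V" for c u v
    using B that unfolding hermitian_form_on_def by blast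
  have sym: "B v u = cnj (B u v)" if "u \<in> V" "v \<in> V" for u v
    using B that unfolding hermitian_form_on_def by blast
  have zero: "B 0 w = 0" if "w \<in> V" for w
    using scale[of 0 w 0] cvs.subspace_0[OF V] that by simp
  have left: "B (\<Sum>i\<in>S. cscale (a i) (f i)) w = (\<Sum>i\<in>S. a i * B (f i) w)"
    if "f ` S \<subseteq> V" "w \<in> V" for S w and f :: "'i \<Rightarrow> 'a \<Rightarrow> complex" and a
    using that(1)
  proof (induction S rule: infinite_finite_induct)
    case (insert i S)
    then have "(\<Sum>i\<in>S. cscale (a i) (f i)) \<in> V" "f i \<in> V" "cscale (a i) (f i) \<in> V"
      using V by (auto intro!: cvs.subspace_sum cvs.subspace_scale)
    with insert show ?case
      by (simp only: sum.insert insert_subset image_insert add scale that(2) not_False_eq_True)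
  qed (simp_all only: sum.infinite sum.empty zero that(2) not_False_eq_True)
  have inV: "(\<Sum>j\<in>T. cscale (b j) (g j)) \<in> V"
    using assms(4) V by (auto intro!: cvs.subspace_sum cvs.subspace_scale)
  have right: "B u (\<Sum>j\<in>T. cscale (b j) (g j)) = (\<Sum>j\<in>T. cnj (b j) * B u (g j))" if "u \<in> V" for u
  proof -
    have "B u (\<Sum>j\<in>T. cscale (b j) (g j)) = cnj (\<Sum>j\<in>T. b j * B (g j) u)"
      using sym[OF inV that] left[OF assms(4) that] by simp
    also have "\<dots> = (\<Sum>j\<in>T. cnj (b j) * B u (g j))"
      unfolding cnj_sum by (rule sum.cong) (use sym[OF _ that] assms(4) in auto)
    finally show ?thesis .
  qed
  show ?thesis
    unfolding left[OF assms(3) inV]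
  proof (rule sum.cong[OF refl])
    fix i assume "i \<in> S"
    then have "f i \<in> V" using assms(3) by blast
    then show "a i * B (f i) (\<Sum>j\<in>T. cscale (b j) (g j)) = (\<Sum>j\<in>T. a i * cnj (b j) * B (f i) (g j))"
      by (simp only: right sum_distrib_left mult.assoc)
  qed
qed

lemma hermitian_comb:
  assumes B: "hermitian_form_on V B" and V: "cvs.subspace V"
    and "u \<in> V" "v \<in> V" "w \<in> V" "z \<in> V"
  shows "B (cscale a u + cscale b v) (cscale c w + cscale d z) =
    a * cnj c * B u w + a * cnj d * B u z + (b * cnj c * B v w + b * cnj d * B v z)"
proof -
  have "B (\<Sum>i\<in>{True, False}. cscale (if i then a else b) (if i then u else v))
      (\<Sum>j\<in>{True, False}. cscale (if j then c else d) (if j then w else z)) =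
    (\<Sum>i\<in>{True, False}. \<Sum>j\<in>{True, False}. (if i then a else b) * cnj (if j then c else d) *
      B (if i then u else v) (if j then w else z))"
    by (rule hermitian_sum[OF B V]) (use assms in auto)
  then show ?thesis by simp
qed

lemma hermitian_form_on_scale:
  assumes B: "hermitian_form_on V B"
  shows "hermitian_form_on V (\<lambda>u v. complex_of_real c * B u v)"
proof -
  have add: "B (u + v) w = B u w + B v w" if "u \<in> V" "v \<in> V" "w \<in> V" for u v w
    using B that unfolding hermitian_form_on_def by blast
  have scale: "B (cscale a u) v = a * B u v" if "u \<in> V" "v \<in> V" for a u v
    using B that unfolding hermitian_form_on_def by blast
  have sym: "B v u = cnj (B u v)" if "u \<in> V" "v \<in> V" for u v
    using B that unfolding hermitian_form_on_def by blast
  show ?thesis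
    unfolding hermitian_form_on_def
  proof (intro conjI ballI allI)
    fix u v assume "u \<in> V" "v \<in> V"
    then show "of_real c * B v u = cnj (of_real c * B u v)" by (subst sym) simp_all
  qed (simp_all add: add scale distrib_left)
qed

lemma hermitian_real:
  assumes "hermitian_form_on V B" "v \<in> V"
  shows "B v v = of_real (Re (B v v))"
proof -
  have "B v v = cnj (B v v)" using assms unfolding hermitian_form_on_def by blast
  then have "Im (B v v) = 0" by (metis cnj.simps(2) neg_equal_zero)
  then show ?thesis by (simp add: complex_eq_iff)
qed

text \<open>The vectors of \<open>b\<close> with positive norm are independent of those of \<open>b'\<close> with nonpositive norm, because on the
  intersection of their spans the form is both positive definite and nonpositive. Comparing with the size of \<open>b'\<close>
  gives the inequality.\<close>
lemma positive_count_le: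
  assumes B: "hermitian_form_on V B" and V: "cvs.subspace V"
    and b: "orthogonal_basis V B b" and b': "orthogonal_basis V B b'"
  shows "card {v \<in> b. 0 < Re (B v v)} \<le> card {v \<in> b'. 0 < Re (B v v)}"
proof -
  define P where "P = {v \<in> b. 0 < Re (B v v)}"
  define N where "N = {v \<in> b'. \<not> 0 < Re (B v v)}"
  have fin: "finite b" "finite b'" "finite P" "finite N"
    using b b' by (auto simp: orthogonal_basis_def P_def N_def)
  have "b \<subseteq> cvs.span b" "b' \<subseteq> cvs.span b'" by (rule cvs.span_superset)+
  then have sub: "b \<subseteq> V" "b' \<subseteq> V"
    using b b' by (simp_all add: orthogonal_basis_def)
  then have subPN: "P \<subseteq> V" "N \<subseteq> V" by (auto simp: P_def N_def)
  have orthP: "B u v = 0" if "u \<in> P" "v \<in> P" "u \<noteq> v" for u v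
    using b that by (auto simp: P_def orthogonal_basis_def)
  have orthN: "B u v = 0" if "u \<in> N" "v \<in> N" "u \<noteq> v" for u v
    using b' that by (auto simp: N_def orthogonal_basis_def)
  have diag: "B (\<Sum>v\<in>S. cscale (u v) v) (\<Sum>v\<in>S. cscale (u v) v) =
      of_real (\<Sum>v\<in>S. (cmod (u v))\<^sup>2 * Re (B v v))"
    if "finite S" "S \<subseteq> V" "\<And>v w. v \<in> S \<Longrightarrow> w \<in> S \<Longrightarrow> v \<noteq> w \<Longrightarrow> B v w = 0" for S u
  proof -
    have "B (\<Sum>v\<in>S. cscale (u v) v) (\<Sum>v\<in>S. cscale (u v) v) =
       (\<Sum>v\<in>S. \<Sum>w\<in>S. u v * cnj (u w) * B v w)"
      using hermitian_sum[OF B V, of "\<lambda>v. v" S "\<lambda>v. v" S u u] that(2) by simp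
    also have "\<dots> = (\<Sum>v\<in>S. \<Sum>w\<in>S. if w = v then u v * cnj (u v) * B v v else 0)"
      by (intro sum.cong) (auto simp: that(3))
    also have "\<dots> = (\<Sum>v\<in>S. u v * cnj (u v) * B v v)"
      using that(1) by simp
    also have "\<dots> = (\<Sum>v\<in>S. of_real ((cmod (u v))\<^sup>2 * Re (B v v)))"
    proof (rule sum.cong[OF refl])
      fix v assume "v \<in> S"
      then have "B v v = of_real (Re (B v v))" using hermitian_real[OF B] that(2) by blast
      then show "u v * cnj (u v) * B v v = of_real ((cmod (u v))\<^sup>2 * Re (B v v))"
        by (metis complex_norm_square of_real_mult)
    qed
    finally show ?thesis by simp
  qed
  have disj: "P \<inter> N = {}" by (auto simp: P_def N_def)
  have "cvs.independent (P \<union> N)"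
  proof
    assume "cvs.dependent (P \<union> N)"
    then obtain u v where u: "v \<in> P \<union> N" "u v \<noteq> 0" "(\<Sum>v\<in>P \<union> N. cscale (u v) v) = 0"
      using cvs.dependent_finite[of "P \<union> N"] fin by auto
    define x where "x = (\<Sum>v\<in>P. cscale (u v) v)"
    define y where "y = (\<Sum>v\<in>N. cscale (u v) v)"
    have xy: "x + y = 0"
      using u(3) unfolding x_def y_def sum.union_disjoint[OF fin(3,4) disj] .
    have "(\<Sum>v\<in>N. cscale (- u v) v) = - y"
      unfolding y_def by (simp only: cvs.scale_minus_left sum_negf)
    then have xN: "x = (\<Sum>v\<in>N. cscale (- u v) v)" using xy by (metis eq_neg_iff_add_eq_0)
    \<comment> \<open>the norm of \<open>x = -y\<close>, computed in both bases\<close>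
    have "complex_of_real (\<Sum>v\<in>P. (cmod (u v))\<^sup>2 * Re (B v v)) = B x x"
      unfolding x_def using diag[OF fin(3) subPN(1) orthP] by simp
    also have "\<dots> = of_real (\<Sum>v\<in>N. (cmod (- u v))\<^sup>2 * Re (B v v))"
      unfolding xN by (rule diag[OF fin(4) subPN(2) orthN])
    finally have eq: "(\<Sum>v\<in>P. (cmod (u v))\<^sup>2 * Re (B v v)) = (\<Sum>v\<in>N. (cmod (- u v))\<^sup>2 * Re (B v v))"
      by (simp only: of_real_eq_iff)
    have "(\<Sum>v\<in>N. (cmod (- u v))\<^sup>2 * Re (B v v)) \<le> 0"
      by (rule sum_nonpos) (auto simp: N_def mult_nonneg_nonpos)
    moreover have nonneg: "0 \<le> (cmod (u v))\<^sup>2 * Re (B v v)" if "v \<in> P" for v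
      using that by (auto simp: P_def)
    ultimately have "(\<Sum>v\<in>P. (cmod (u v))\<^sup>2 * Re (B v v)) = 0"
      using eq sum_nonneg[of P "\<lambda>v. (cmod (u v))\<^sup>2 * Re (B v v)"] by simp
    then have "(cmod (u v))\<^sup>2 * Re (B v v) = 0" if "v \<in> P" for v
      using sum_nonneg_eq_0_iff[OF fin(3), of "\<lambda>v. (cmod (u v))\<^sup>2 * Re (B v v)"] nonneg that by blast
    then have uP: "u v = 0" if "v \<in> P" for v using that by (fastforce simp: P_def)
    have "x = 0" unfolding x_def by (intro sum.neutral ballI) (simp only: uP cvs.scale_zero_left)
    then have "y = 0" using xy by (simp only: add_0)
    moreover have "cvs.independent N"
      using b' cvs.independent_mono[of b' N] by (auto simp: orthogonal_basis_def N_def)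
    ultimately have "u v = 0" if "v \<in> N" for v
      using that cvs.dependent_finite[OF fin(4)] unfolding y_def by blast
    with uP u(1,2) show False by blast
  qed
  moreover have "P \<union> N \<subseteq> cvs.span b'"
    using subPN b' by (auto simp: orthogonal_basis_def)
  ultimately have "card (P \<union> N) \<le> card b'"
    using cvs.independent_span_bound[OF fin(2)] by blast
  moreover have "card (P \<union> N) = card P + card N" using fin disj by (simp add: card_Un_disjoint)
  moreover have "card b' = card {v \<in> b'. 0 < Re (B v v)} + card N"
  proof -
    have "b' = {v \<in> b'. 0 < Re (B v v)} \<union> N" by (auto simp: N_def)
    then show ?thesis
      using card_Un_disjoint[of "{v \<in> b'. 0 < Re (B v v)}" N] fin by (auto simp: N_def)
  qed
  ultimately show ?thesis unfolding P_def by simp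
qed

text \<open>Sylvester's law of inertia: any orthogonal basis computes the refined signature.\<close>
lemma refined_signature_orthogonal_basis:
  assumes B: "hermitian_form_on V B" and V: "cvs.subspace V" and b: "orthogonal_basis V B b"
  shows "refined_signature V B =
    of_nat (card {v \<in> b. 0 < Re (B v v)}) + of_nat (card {v \<in> b. Re (B v v) < 0}) * zz"
proof -
  define b' where "b' = (SOME b. orthogonal_basis V B b)"
  have b': "orthogonal_basis V B b'" unfolding b'_def using b by (rule someI)
  have neg: "hermitian_form_on V (\<lambda>u v. - B u v)"
    using hermitian_form_on_scale[OF B, of "-1"] by simp
  have neg_basis: "orthogonal_basis V (\<lambda>u v. - B u v) c" if "orthogonal_basis V B c" for c
    using that by (simp add: orthogonal_basis_def)
  have "card {v \<in> b'. 0 < Re (B v v)} = card {v \<in> b. 0 < Re (B v v)}"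
    using positive_count_le[OF B V b b'] positive_count_le[OF B V b' b] by simp
  moreover have "card {v \<in> b'. Re (B v v) < 0} = card {v \<in> b. Re (B v v) < 0}"
    using positive_count_le[OF neg V neg_basis[OF b] neg_basis[OF b']]
      positive_count_le[OF neg V neg_basis[OF b'] neg_basis[OF b]] by simp
  ultimately show ?thesis
    unfolding refined_signature_def Let_def b'_def[symmetric] by (simp add: b'_def[symmetric])
qed

section \<open>The invariant forms on the Specht module\<close>

text \<open>The sign of a nonzero real number as an element of \<open>{1, z}\<close>; it is multiplicative.\<close>
definition sign_class :: "real \<Rightarrow> sigring" where
  "sign_class x = (if 0 < x then 1 else zz)"

lemma sign_class_mult: "x \<noteq> 0 \<Longrightarrow> y \<noteq> 0 \<Longrightarrow> sign_class (x * y) = sign_class x * sign_class y"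
  by (auto simp: sign_class_def zz_times_zz zero_less_mult_iff not_less)

lemma sign_class_prod: "finite A \<Longrightarrow> (\<And>i. i \<in> A \<Longrightarrow> f i \<noteq> 0) \<Longrightarrow> sign_class (\<Prod>i\<in>A. f i) = (\<Prod>i\<in>A. sign_class (f i))"
  by (induction A rule: finite_induct) (auto simp: sign_class_mult, simp add: sign_class_def)

lemma hecke_T_sum: "hecke_T Q i (\<Sum>j\<in>A. cscale (c j) (f j)) = (\<Sum>j\<in>A. cscale (c j) (hecke_T Q i (f j)))"
proof (induction A rule: infinite_finite_induct)
  case (insert j A)
  then show ?case by (simp only: sum.insert hecke_T_add hecke_T_scale not_False_eq_True)
qed (simp_all only: sum.infinite sum.empty not_False_eq_True hecke_T_scale[of Q i 0 0, unfolded cvs.scale_zero_left])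

context generic_unit
begin

abbreviation path_vec :: "nat \<Rightarrow> nat set \<Rightarrow> tabvec" where "path_vec n D \<equiv> seminormal Q D n 0"

text \<open>The span of the seminormal highest weight vectors of the paths with \<open>m\<close> down steps; it is the Specht module.\<close>
definition path_span :: "nat \<Rightarrow> nat \<Rightarrow> tabvec set" where
  "path_span n m = cvs.span (path_vec n ` two_row_paths n m)"

abbreviation nrm :: "nat \<Rightarrow> nat set \<Rightarrow> complex" where "nrm n D \<equiv> complex_of_real (path_norm q D n)"

lemma path_vec_basis: "inj_on (path_vec n) (two_row_paths n m)" "cvs.independent (path_vec n ` two_row_paths n m)"
proof -
  let ?P = "two_row_paths n m"
  have "inj_on (\<lambda>D. D \<inter> {1..n}) ?P"
    by (intro inj_onI) (auto simp: two_row_paths_def Int_absorb2)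
  moreover have "ballot D n" if "D \<in> ?P" for D using that by (simp add: two_row_paths_def)
  ultimately have ind: "c D = 0" if "(\<Sum>D\<in>?P. cscale (c D) (path_vec n D)) = 0" "D \<in> ?P" for c D
    using seminormal_family_independent[OF qnum_nz _ finite_two_row_paths _ _ that] q_nz by simp
  show "inj_on (path_vec n) ?P"
    by (rule family_independentD(1)[where P = ?P and x = "path_vec n"], rule finite_two_row_paths, erule (1) ind)
  show "cvs.independent (path_vec n ` ?P)"
    by (rule family_independentD(2)[where P = ?P and x = "path_vec n"], rule finite_two_row_paths, erule (1) ind)
qed

lemma subspace_path_span: "cvs.subspace (path_span n m)"
  unfolding path_span_def by (rule cvs.subspace_span)

lemma path_vec_in: "D \<in> two_row_paths n m \<Longrightarrow> path_vec n D \<in> path_span n m"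
  unfolding path_span_def by (intro cvs.span_base imageI)

lemma hecke_T_path_vec:
  assumes "D \<in> two_row_paths n m" "Suc l < n"
  shows "hecke_T Q (Suc l) (path_vec n D) = cscale (diag_coeff l D) (path_vec n D) + cscale (off_coeff l D) (path_vec n (partner l D))"
  using hecke_T_seminormal[of D n l 0] assms by (simp add: two_row_paths_def)

lemma path_span_closed:
  assumes "v \<in> path_span n m" "i \<in> {1..<n}"
  shows "hecke_T Q i v \<in> path_span n m"
proof -
  obtain l where l: "i = Suc l" "Suc l < n" using assms(2) by (cases i) auto
  let ?W = "{v. hecke_T Q i v \<in> path_span n m}"
  have V: "cvs.subspace (path_span n m)" by (rule subspace_path_span)
  have "cvs.subspace ?W"
  proof (rule cvs.subspaceI)
    have "hecke_T Q i 0 = 0" using hecke_T_scale[of Q i 0 0] by (simp only: cvs.scale_zero_left)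
    then show "0 \<in> ?W" using cvs.subspace_0[OF V] by (simp only: mem_Collect_eq)
  qed (simp_all only: mem_Collect_eq hecke_T_add hecke_T_scale cvs.subspace_add[OF V] cvs.subspace_scale[OF V])
  moreover have "path_vec n ` two_row_paths n m \<subseteq> ?W"
  proof (rule image_subsetI, rule CollectI)
    fix D assume D: "D \<in> two_row_paths n m"
    show "hecke_T Q i (path_vec n D) \<in> path_span n m"
      unfolding l(1) hecke_T_path_vec[OF D l(2)]
      by (intro cvs.subspace_add[OF V] cvs.subspace_scale[OF V] path_vec_in D partner_in l(2))
  qed
  ultimately have "path_span n m \<subseteq> ?W" unfolding path_span_def by (rule cvs.span_minimal[rotated])
  then show ?thesis using assms(1) by blast
qed

text \<open>The span is invariant and contains the generator. Conversely, a submodule that contains the generator contains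
  the vector of the zigzag path, and then, along the nonzero matrix entries, the vectors of all paths.\<close>
lemma specht_eq_path_span:
  assumes "2 * m \<le> n"
  shows "specht Q [n - m, m] = path_span n m"
proof
  have mn: "sum_list [n - m, m] = n" using assms by simp
  obtain c where c: "c \<noteq> 0" "path_vec n (zigzag m) = cscale c (specht_generator Q [n - m, m])"
    using seminormal_zigzag[OF _ assms] q_nz unfolding specht_generator_two_row[OF assms]
    by (metis power_not_zero)
  then have g: "specht_generator Q [n - m, m] = cscale (inverse c) (path_vec n (zigzag m))" by simp
  have "specht_generator Q [n - m, m] \<in> path_span n m"
    unfolding g by (intro cvs.subspace_scale[OF subspace_path_span] path_vec_in zigzag_in_paths assms)
  then show "specht Q [n - m, m] \<subseteq> path_span n m"
    unfolding specht_def mn using subspace_path_span path_span_closed by blast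
  show "path_span n m \<subseteq> specht Q [n - m, m]"
    unfolding specht_def mn
  proof (rule Inter_greatest)
    fix U assume "U \<in> {U. cvs.subspace U \<and> specht_generator Q [n - m, m] \<in> U \<and>
      (\<forall>i\<in>{1..<n}. \<forall>u\<in>U. hecke_T Q i u \<in> U)}"
    then have U: "cvs.subspace U" "specht_generator Q [n - m, m] \<in> U"
      "\<And>i u. i \<in> {1..<n} \<Longrightarrow> u \<in> U \<Longrightarrow> hecke_T Q i u \<in> U" by auto
    have "path_vec n D \<in> U" if "D \<in> two_row_paths n m" for D
      using that
    proof (rule path_induct)
      show "path_vec n (zigzag m) \<in> U" unfolding c(2) by (rule cvs.subspace_scale[OF U(1,2)])
    next
      fix D l assume D: "D \<in> two_row_paths n m" and l: "Suc l < n" "off_coeff l D \<noteq> 0" and IH: "path_vec n D \<in> U"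
      have "hecke_T Q (Suc l) (path_vec n D) \<in> U" using U(3)[of "Suc l"] IH l by simp
      then have "cscale (inverse (off_coeff l D)) (hecke_T Q (Suc l) (path_vec n D) - cscale (diag_coeff l D) (path_vec n D)) \<in> U"
        using IH by (intro cvs.subspace_scale cvs.subspace_diff U(1))
      also have "cscale (inverse (off_coeff l D)) (hecke_T Q (Suc l) (path_vec n D) - cscale (diag_coeff l D) (path_vec n D)) =
          path_vec n (partner l D)"
        unfolding hecke_T_path_vec[OF D l(1)] using l(2) by simp
      finally show "path_vec n (partner l D) \<in> U" .
    qed
    then show "path_span n m \<subseteq> U"
      unfolding path_span_def by (intro cvs.span_minimal U(1)) auto
  qed
qed

lemma jucys_murphy_in:
  assumes "k < n" "v \<in> path_span n m"
  shows "jucys_murphy k v \<in> path_span n m"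
  using assms
proof (induction k arbitrary: v)
  case (Suc k)
  have i: "Suc k \<in> {1..<n}" using Suc.prems by simp
  have "jucys_murphy k (hecke_T Q (Suc k) v) \<in> path_span n m"
    using Suc path_span_closed[OF Suc.prems(2) i] by simp
  from path_span_closed[OF this i] show ?case by simp
qed simp

lemma jucys_murphy_unitary:
  assumes "invariant_form n (path_span n m) (hecke_T Q) B" "k < n"
    "u \<in> path_span n m" "v \<in> path_span n m"
  shows "B (jucys_murphy k u) (jucys_murphy k v) = B u v"
  using assms(2-)
proof (induction k arbitrary: u v)
  case (Suc k)
  have i: "Suc k \<in> {1..<n}" using Suc.prems by simp
  have T: "B (hecke_T Q (Suc k) a) (hecke_T Q (Suc k) b) = B a b"
    if "a \<in> path_span n m" "b \<in> path_span n m" for a b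
    using assms(1) i that unfolding invariant_form_def by blast
  note c = path_span_closed[OF Suc.prems(2) i] path_span_closed[OF Suc.prems(3) i]
  have "B (jucys_murphy (Suc k) u) (jucys_murphy (Suc k) v) = B (jucys_murphy k (hecke_T Q (Suc k) u)) (jucys_murphy k (hecke_T Q (Suc k) v))"
    using T jucys_murphy_in c Suc.prems(1) by simp
  also have "\<dots> = B (hecke_T Q (Suc k) u) (hecke_T Q (Suc k) v)"
    using Suc.IH c Suc.prems(1) by simp
  also have "\<dots> = B u v" using T Suc.prems by simp
  finally show ?case .
qed simp

text \<open>The Jucys--Murphy elements are unitary for every invariant form, so eigenvectors for distinct eigenvalues of
  modulus 1 are orthogonal.\<close>
lemma invariant_orthogonal:
  assumes B: "invariant_form n (path_span n m) (hecke_T Q) B"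
    and DE: "D \<in> two_row_paths n m" "E \<in> two_row_paths n m" "D \<noteq> E"
  shows "B (path_vec n D) (path_vec n E) = 0"
proof -
  obtain k where k: "k < n" "jm_eigenvalue k D \<noteq> jm_eigenvalue k E"
    using jm_eigenvalue_separates[of D n E] DE by (auto simp: two_row_paths_def)
  have H: "hermitian_form_on (path_span n m) B" using B by (simp add: invariant_form_def)
  have "B (path_vec n D) (path_vec n E) = B (jucys_murphy k (path_vec n D)) (jucys_murphy k (path_vec n E))"
    using jucys_murphy_unitary[OF B k(1)] path_vec_in DE by simp
  also have "\<dots> = B (cscale (jm_eigenvalue k D) (path_vec n D)) (cscale (jm_eigenvalue k E) (path_vec n E))"
    using jucys_murphy_seminormal[OF k(1)] DE by (simp add: two_row_paths_def)
  also have "\<dots> = jm_eigenvalue k D * cnj (jm_eigenvalue k E) * B (path_vec n D) (path_vec n E)"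
    using hermitian_comb[OF H subspace_path_span path_vec_in[OF DE(1)] path_vec_in[OF DE(1)] path_vec_in[OF DE(2)] path_vec_in[OF DE(2)],
        of "jm_eigenvalue k D" 0 "jm_eigenvalue k E" 0]
    by simp
  finally have "B (path_vec n D) (path_vec n E) = 0 \<or> jm_eigenvalue k D * cnj (jm_eigenvalue k E) = 1"
    by (metis mult_cancel_right2)
  moreover have "jm_eigenvalue k D * cnj (jm_eigenvalue k E) \<noteq> 1"
  proof
    assume "jm_eigenvalue k D * cnj (jm_eigenvalue k E) = 1"
    then have "jm_eigenvalue k D * (jm_eigenvalue k E * cnj (jm_eigenvalue k E)) = jm_eigenvalue k E" by (metis mult.commute mult.left_commute mult_1_right)
    then show False using k(2) unit_times_cnj[OF jm_eigenvalue_unit] by simp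
  qed
  ultimately show ?thesis by blast
qed

text \<open>The form is determined by its value on the zigzag path: invariance of the norm of \<open>x\<^sub>D\<close> under \<open>T\<^bsub>l+1\<^esub>\<close>, compared with
  the same relation for \<^const>\<open>path_norm\<close>, gives the norm of the partner.\<close>
lemma invariant_norms:
  assumes B: "invariant_form n (path_span n m) (hecke_T Q) B" and m: "2 * m \<le> n"
    and D: "D \<in> two_row_paths n m"
  shows "B (path_vec n D) (path_vec n D) * nrm n (zigzag m) = B (path_vec n (zigzag m)) (path_vec n (zigzag m)) * nrm n D"
  using D
proof (rule path_induct)
  fix D l
  let ?E = "partner l D" and ?z = "zigzag m"
  let ?b = "\<lambda>D. B (path_vec n D) (path_vec n D)"
  assume D: "D \<in> two_row_paths n m" and l: "Suc l < n" "off_coeff l D \<noteq> 0" "swappable l D"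
    and IH: "?b D * nrm n ?z = ?b ?z * nrm n D"
  have H: "hermitian_form_on (path_span n m) B" using B by (simp add: invariant_form_def)
  have E: "?E \<in> two_row_paths n m" using partner_in D l by blast
  have z: "B (path_vec n D) (path_vec n ?E) = 0" "B (path_vec n ?E) (path_vec n D) = 0"
    using invariant_orthogonal[OF B] D E partner_ne[OF l(3)] by metis+
  have "Suc l \<in> {1..<n}" using l by simp
  then have "B (hecke_T Q (Suc l) (path_vec n D)) (hecke_T Q (Suc l) (path_vec n D)) = ?b D"
    using B path_vec_in[OF D] unfolding invariant_form_def by blast
  then have 1: "diag_coeff l D * cnj (diag_coeff l D) * ?b D + off_coeff l D * cnj (off_coeff l D) * ?b ?E = ?b D"
    unfolding hecke_T_path_vec[OF D l(1)]
      hermitian_comb[OF H subspace_path_span path_vec_in[OF D] path_vec_in[OF E] path_vec_in[OF D] path_vec_in[OF E]] z by simp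
  note 2 = block_unitary(1)[OF l(3,1)]
  let ?s = "off_coeff l D * cnj (off_coeff l D)"
  have "?s * (?b ?E * nrm n ?z) = (1 - diag_coeff l D * cnj (diag_coeff l D)) * (?b D * nrm n ?z)"
    using arg_cong[OF 1, of "\<lambda>x. x * nrm n ?z"] by (simp add: algebra_simps)
  also have "\<dots> = ?b ?z * ((1 - diag_coeff l D * cnj (diag_coeff l D)) * nrm n D)" unfolding IH by simp
  also have "\<dots> = ?s * (?b ?z * nrm n ?E)"
    using arg_cong[OF 2, of "\<lambda>x. ?b ?z * x"] by (simp add: algebra_simps)
  finally show "?b ?E * nrm n ?z = ?b ?z * nrm n ?E" using l(2) by simp
qed simp

lemma refined_signature_paths:
  assumes H: "hermitian_form_on (path_span n m) B"
    and B: "\<And>D E. D \<in> two_row_paths n m \<Longrightarrow> E \<in> two_row_paths n m \<Longrightarrow>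
      B (path_vec n D) (path_vec n E) = (if D = E then nrm n D else 0)"
  shows "refined_signature (path_span n m) B = (\<Sum>D\<in>two_row_paths n m. sign_class (path_norm q D n))"
proof -
  let ?P = "two_row_paths n m"
  have inj: "inj_on (path_vec n) ?P" by (rule path_vec_basis)
  have "orthogonal_basis (path_span n m) B (path_vec n ` ?P)"
    unfolding orthogonal_basis_def path_span_def
    using finite_two_row_paths path_vec_basis(2) B by auto
  note S = refined_signature_orthogonal_basis[OF H subspace_path_span this]
  have "{v \<in> path_vec n ` ?P. 0 < Re (B v v)} = path_vec n ` {D \<in> ?P. 0 < path_norm q D n}" using B by auto
  moreover have "{v \<in> path_vec n ` ?P. Re (B v v) < 0} = path_vec n ` {D \<in> ?P. path_norm q D n < 0}" using B by auto
  moreover have "inj_on (path_vec n) {D \<in> ?P. 0 < path_norm q D n}" "inj_on (path_vec n) {D \<in> ?P. path_norm q D n < 0}"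
    by (rule inj_on_subset[OF inj], blast)+
  ultimately have "refined_signature (path_span n m) B =
    of_nat (card {D \<in> ?P. 0 < path_norm q D n}) + of_nat (card {D \<in> ?P. path_norm q D n < 0}) * zz"
    unfolding S by (simp only: card_image)
  also have "\<dots> = (\<Sum>D\<in>{D \<in> ?P. 0 < path_norm q D n}. sign_class (path_norm q D n)) +
     (\<Sum>D\<in>{D \<in> ?P. path_norm q D n < 0}. sign_class (path_norm q D n))"
    by (simp add: sign_class_def)
  also have "\<dots> = (\<Sum>D\<in>{D \<in> ?P. 0 < path_norm q D n} \<union> {D \<in> ?P. path_norm q D n < 0}. sign_class (path_norm q D n))"
    using finite_two_row_paths by (intro sum.union_disjoint[symmetric]) auto
  also have "{D \<in> ?P. 0 < path_norm q D n} \<union> {D \<in> ?P. path_norm q D n < 0} = ?P"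
    using path_norm_nz by (force simp: two_row_paths_def)
  finally show ?thesis .
qed

text \<open>The factor \<open>c\<close> turns the value on the zigzag path, which is nonzero because the form is nondegenerate, into the
  norm of that path.\<close>
lemma invariant_signature:
  assumes B: "invariant_form n (path_span n m) (hecke_T Q) B" and m: "2 * m \<le> n"
  shows "\<exists>c::real. c \<noteq> 0 \<and> refined_signature (path_span n m) (\<lambda>u v. complex_of_real c * B u v) =
    (\<Sum>D\<in>two_row_paths n m. sign_class (path_norm q D n))"
proof -
  let ?P = "two_row_paths n m" and ?z = "zigzag m"
  have H: "hermitian_form_on (path_span n m) B" and nd: "nondegenerate_on (path_span n m) B"
    using B by (simp_all add: invariant_form_def)
  have zP: "?z \<in> ?P" by (rule zigzag_in_paths[OF m])
  define b where "b = Re (B (path_vec n ?z) (path_vec n ?z))"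
  have b: "B (path_vec n ?z) (path_vec n ?z) = of_real b"
    using hermitian_real[OF H path_vec_in[OF zP]] by (simp add: b_def)
  have nz: "path_norm q ?z n \<noteq> 0" using zP path_norm_nz by (simp add: two_row_paths_def)
  have "b \<noteq> 0"
  proof
    assume "b = 0"
    then have 0: "B (path_vec n ?z) (path_vec n E) = 0" if "E \<in> ?P" for E
      using invariant_orthogonal[OF B zP that] b by (cases "E = ?z") auto
    have "B (path_vec n ?z) v = 0" if v: "v \<in> path_span n m" for v
    proof -
      obtain c where c: "v = (\<Sum>x\<in>path_vec n ` ?P. cscale (c x) x)"
        using v cvs.span_finite[of "path_vec n ` ?P"] finite_two_row_paths unfolding path_span_def by auto
      have sub: "(\<lambda>x. x) ` path_vec n ` ?P \<subseteq> path_span n m" using path_vec_in by auto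
      have "B (\<Sum>x\<in>{path_vec n ?z}. cscale 1 x) v = 0"
        unfolding c
        by (subst hermitian_sum[OF H subspace_path_span _ sub]) (use path_vec_in[OF zP] 0 in \<open>auto intro!: sum.neutral\<close>)
      then show ?thesis by simp
    qed
    then have "path_vec n ?z = 0" using nd path_vec_in[OF zP] unfolding nondegenerate_on_def by blast
    from image_eqI[where f = "path_vec n", OF this[symmetric] zP] have "0 \<in> path_vec n ` ?P" .
    then have "cvs.dependent (path_vec n ` ?P)" by (rule cvs.dependent_zero)
    with path_vec_basis(2)[of n m] show False ..
  qed
  define c where "c = path_norm q ?z n / b"
  have c: "c \<noteq> 0" using nz \<open>b \<noteq> 0\<close> by (simp add: c_def)
  have "hermitian_form_on (path_span n m) (\<lambda>u v. of_real c * B u v)"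
    using H by (rule hermitian_form_on_scale)
  moreover have "of_real c * B (path_vec n D) (path_vec n E) = (if D = E then nrm n D else 0)"
    if "D \<in> ?P" "E \<in> ?P" for D E
  proof (cases "D = E")
    case True
    have "B (path_vec n D) (path_vec n D) * nrm n ?z = of_real b * nrm n D"
      using invariant_norms[OF B m that(1)] b by simp
    then show ?thesis using True \<open>b \<noteq> 0\<close> by (simp add: c_def field_simps)
  qed (use invariant_orthogonal[OF B that] in simp)
  ultimately show ?thesis using refined_signature_paths c by blast
qed

text \<open>The form that is diagonal in the seminormal basis with entries \<^const>\<open>path_norm\<close> is invariant.\<close>
lemma invariant_exists: "\<exists>B. invariant_form n (path_span n m) (hecke_T Q) B"
proof -
  let ?P = "two_row_paths n m" and ?V = "path_span n m"
  \<comment> \<open>the coordinates with respect to the seminormal basis\<close>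
  define co where "co = (\<lambda>u D. cvs.representation (path_vec n ` ?P) u (path_vec n D))"
  define B where "B = (\<lambda>u v. \<Sum>D\<in>?P. nrm n D * (co u D * cnj (co v D)))"
  note ind = path_vec_basis(2)[of n m]
  have add: "co (u + v) D = co u D + co v D" if "u \<in> ?V" "v \<in> ?V" for u v D
    using cvs.representation_add[OF ind] that by (simp add: co_def path_span_def)
  have scale: "co (cscale c u) D = c * co u D" if "u \<in> ?V" for c u D
    using cvs.representation_scale[OF ind] that by (simp add: co_def path_span_def)
  have basis: "co (path_vec n E) D = (if D = E then 1 else 0)" if "D \<in> ?P" "E \<in> ?P" for D E
    using cvs.representation_basis[OF ind, of "path_vec n E"] that inj_on_eq_iff[OF path_vec_basis(1)]
    by (simp add: co_def)
  have expand: "u = (\<Sum>D\<in>?P. cscale (co u D) (path_vec n D))" if "u \<in> ?V" for u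
  proof -
    have "u = (\<Sum>v\<in>path_vec n ` ?P. cscale (cvs.representation (path_vec n ` ?P) u v) v)"
      using cvs.sum_representation_eq[OF ind, of u "path_vec n ` ?P"] that finite_two_row_paths
      by (simp add: path_span_def)
    also have "\<dots> = (\<Sum>D\<in>?P. cscale (co u D) (path_vec n D))"
      by (subst sum.reindex[OF path_vec_basis(1)]) (simp add: co_def comp_def)
    finally show ?thesis .
  qed
  have H: "hermitian_form_on ?V B"
    unfolding hermitian_form_on_def B_def
  proof (intro conjI ballI allI)
    fix u v w assume "u \<in> ?V" "v \<in> ?V" "w \<in> ?V"
    then show "(\<Sum>D\<in>?P. nrm n D * (co (u + v) D * cnj (co w D))) =
       (\<Sum>D\<in>?P. nrm n D * (co u D * cnj (co w D))) + (\<Sum>D\<in>?P. nrm n D * (co v D * cnj (co w D)))"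
      unfolding sum.distrib[symmetric] by (intro sum.cong) (simp_all add: add algebra_simps)
  next
    fix c u v assume "u \<in> ?V" "v \<in> ?V"
    then show "(\<Sum>D\<in>?P. nrm n D * (co (cscale c u) D * cnj (co v D))) =
       c * (\<Sum>D\<in>?P. nrm n D * (co u D * cnj (co v D)))"
      unfolding sum_distrib_left by (intro sum.cong) (simp_all add: scale)
  next
    fix u v
    show "(\<Sum>D\<in>?P. nrm n D * (co v D * cnj (co u D))) = cnj (\<Sum>D\<in>?P. nrm n D * (co u D * cnj (co v D)))"
      unfolding cnj_sum by (intro sum.cong) simp_all
  qed
  have right: "B u (path_vec n E) = nrm n E * co u E" if "E \<in> ?P" for u E
  proof -
    have "B u (path_vec n E) = (\<Sum>D\<in>?P. if D = E then nrm n E * co u E else 0)"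
      unfolding B_def using that by (intro sum.cong) (auto simp: basis)
    also have "\<dots> = nrm n E * co u E" using that finite_two_row_paths by simp
    finally show ?thesis .
  qed
  have diag: "B (path_vec n D) (path_vec n E) = (if D = E then nrm n D else 0)" if "D \<in> ?P" "E \<in> ?P" for D E
    using right[OF that(2)] basis[OF that(2,1)] by simp
  have nd: "nondegenerate_on ?V B"
    unfolding nondegenerate_on_def
  proof (intro ballI impI)
    fix u assume u: "u \<in> ?V" "\<forall>v\<in>?V. B u v = 0"
    have "co u D = 0" if "D \<in> ?P" for D
    proof -
      have "nrm n D * co u D = B u (path_vec n D)" by (rule right[OF that, symmetric])
      also have "\<dots> = 0" using u(2) path_vec_in[OF that] by blast
      finally have "nrm n D * co u D = 0" .
      moreover have "path_norm q D n \<noteq> 0" using that path_norm_nz by (simp add: two_row_paths_def)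
      ultimately show ?thesis by simp
    qed
    then have "(\<Sum>D\<in>?P. cscale (co u D) (path_vec n D)) = 0"
      by (intro sum.neutral ballI) (simp only: cvs.scale_zero_left)
    then show "u = 0" using expand[OF u(1)] by (simp only:)
  qed
  have inv: "B (hecke_T Q (Suc l) (path_vec n D)) (hecke_T Q (Suc l) (path_vec n E)) = B (path_vec n D) (path_vec n E)"
    if l: "Suc l < n" and DE: "D \<in> ?P" "E \<in> ?P" for l D E
  proof -
    let ?D = "partner l D" and ?E = "partner l E"
    have DE': "?D \<in> ?P" "?E \<in> ?P" using partner_in DE l by blast+
    have balD: "ballot D n" using DE by (simp add: two_row_paths_def)
    have eq: "B (hecke_T Q (Suc l) (path_vec n D)) (hecke_T Q (Suc l) (path_vec n E)) =
      diag_coeff l D * cnj (diag_coeff l E) * B (path_vec n D) (path_vec n E) + diag_coeff l D * cnj (off_coeff l E) * B (path_vec n D) (path_vec n ?E) +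
      (off_coeff l D * cnj (diag_coeff l E) * B (path_vec n ?D) (path_vec n E) + off_coeff l D * cnj (off_coeff l E) * B (path_vec n ?D) (path_vec n ?E))"
      unfolding hecke_T_path_vec[OF DE(1) l] hecke_T_path_vec[OF DE(2) l]
      by (rule hermitian_comb[OF H subspace_path_span]) (intro path_vec_in DE DE')+
    have partner_eq: "?D = E \<longleftrightarrow> D = ?E" "?D = ?E \<longleftrightarrow> D = E" using partner_partner by metis+
    show ?thesis
    proof (cases "swappable l D")
      case False
      note f = block_fixed[OF False balD l]
      have D: "?D = D" using False by (simp add: partner_def)
      show ?thesis
      proof (cases "D = E")
        case True
        then show ?thesis unfolding eq using f by (simp add: diag[OF DE])
      next
        case False
        then have "D \<noteq> ?E" using partner_eq D by metis
        then show ?thesis unfolding eq using f False by (simp add: diag DE DE')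
      qed
    next
      case True
      note u = block_unitary[OF True l]
      have ne: "?D \<noteq> D" by (rule partner_ne[OF True])
      consider "D = E" | "E = ?D" | "D \<noteq> E" "E \<noteq> ?D" by blast
      then show ?thesis
      proof cases
        case 1
        then show ?thesis unfolding eq using u(1) ne by (simp add: diag DE DE')
      next
        case 2
        then have "?E = D" by (simp add: partner_partner)
        then show ?thesis unfolding eq using u(2) ne 2 by (simp add: diag DE DE')
      next
        case 3
        then have "?D \<noteq> E" "D \<noteq> ?E" "?D \<noteq> ?E" using partner_eq by auto
        then show ?thesis unfolding eq using 3 by (simp add: diag DE DE')
      qed
    qed
  qed
  have "B (hecke_T Q i u) (hecke_T Q i v) = B u v" if i: "i \<in> {1..<n}" and uv: "u \<in> ?V" "v \<in> ?V" for i u v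
  proof -
    obtain l where l: "i = Suc l" "Suc l < n" using i by (cases i) auto
    have T: "hecke_T Q i w = (\<Sum>D\<in>?P. cscale (co w D) (hecke_T Q i (path_vec n D)))" if "w \<in> ?V" for w
      by (subst expand[OF that]) (rule hecke_T_sum)
    have sub: "(\<lambda>D. hecke_T Q i (path_vec n D)) ` ?P \<subseteq> ?V" "path_vec n ` ?P \<subseteq> ?V"
      using path_span_closed[OF path_vec_in i] path_vec_in by auto
    have "B (hecke_T Q i u) (hecke_T Q i v) = (\<Sum>D\<in>?P. \<Sum>E\<in>?P. co u D * cnj (co v E) *
        B (hecke_T Q i (path_vec n D)) (hecke_T Q i (path_vec n E)))"
      unfolding T[OF uv(1)] T[OF uv(2)] by (rule hermitian_sum[OF H subspace_path_span sub(1) sub(1)])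
    also have "\<dots> = (\<Sum>D\<in>?P. \<Sum>E\<in>?P. co u D * cnj (co v E) * B (path_vec n D) (path_vec n E))"
      using inv[OF l(2)] l(1) by (intro sum.cong) simp_all
    also have "\<dots> = B (\<Sum>D\<in>?P. cscale (co u D) (path_vec n D)) (\<Sum>D\<in>?P. cscale (co v D) (path_vec n D))"
      by (rule hermitian_sum[OF H subspace_path_span sub(2) sub(2), symmetric])
    also have "\<dots> = B u v" using expand uv by simp
    finally show ?thesis .
  qed
  then show ?thesis using H nd unfolding invariant_form_def by blast
qed

lemma path_norm_prod: "path_norm q D n = (\<Prod>p\<in>D \<inter> {1..n}. r (height D (p - 1)) * r (Suc (height D (p - 1))))"
proof (induction n)
  case (Suc n)
  have "D \<inter> {1..Suc n} = (if Suc n \<in> D then insert (Suc n) (D \<inter> {1..n}) else D \<inter> {1..n})"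
    by (auto simp: atLeastAtMostSuc_conv)
  then show ?case using Suc by simp
qed simp

text \<open>The \<open>i\<close>-th down step \<open>j\<^sub>i\<close> is preceded by \<open>i - 1\<close> down steps and \<open>j\<^sub>i - i\<close> up steps, so it starts from height
  \<open>j\<^sub>i - (2i - 1)\<close>.\<close>
lemma sign_class_path_norm:
  assumes j: "j \<in> ballot_seqs n m"
  shows "sign_class (path_norm q (j ` {1..m}) n) =
    (\<Prod>i = 1..m. qsign q (int (j i) - (2 * int i - 1)) * qsign q (int (j i) - 2 * (int i - 1)))"
proof -
  let ?D = "j ` {1..m}"
  note jd = ballot_seqsD[OF j]
  have P: "?D \<in> two_row_paths n m" using j bij_betw_ballot_seqs[of m n] by (auto simp: bij_betw_def)
  then have bal: "ballot ?D n" and sub: "?D \<inter> {1..n} = ?D" by (auto simp: two_row_paths_def)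
  have h: "0 < height ?D (j i - 1)" "int (height ?D (j i - 1)) = int (j i) - (2 * int i - 1)"
    if i: "i \<in> {1..m}" for i
  proof -
    have "ballot ?D (j i - 1)" using ballot_mono[OF bal] jd(3) i by (metis diff_le_self le_trans)
    from height_downs[OF this] have "height ?D (j i - 1) + 2 * (i - 1) = j i - 1"
      unfolding downs_image(2)[OF jd(1,2) i] .
    moreover have "2 * i \<le> j i" "1 \<le> i" using jd(4) i by auto
    ultimately show "0 < height ?D (j i - 1)" "int (height ?D (j i - 1)) = int (j i) - (2 * int i - 1)"
      by linarith+
  qed
  have "path_norm q ?D n = (\<Prod>i\<in>{1..m}. r (height ?D (j i - 1)) * r (Suc (height ?D (j i - 1))))"
    unfolding path_norm_prod sub by (subst prod.reindex[OF jd(6)]) (simp add: comp_def)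
  then have "sign_class (path_norm q ?D n) = sign_class (\<Prod>i\<in>{1..m}. r (height ?D (j i - 1)) * r (Suc (height ?D (j i - 1))))"
    by (rule arg_cong)
  also have "\<dots> = (\<Prod>i\<in>{1..m}. sign_class (r (height ?D (j i - 1)) * r (Suc (height ?D (j i - 1)))))"
    by (rule sign_class_prod) (use h r_nz in auto)
  also have "\<dots> = (\<Prod>i = 1..m. qsign q (int (j i) - (2 * int i - 1)) * qsign q (int (j i) - 2 * (int i - 1)))"
  proof (rule prod.cong[OF refl])
    fix i assume i: "i \<in> {1..m}"
    have s: "sign_class (r k) = qsign q (int k)" for k by (simp add: sign_class_def rquantum_def qsign_def)
    have "int (Suc (height ?D (j i - 1))) = int (j i) - 2 * (int i - 1)" using h(2)[OF i] by simp
    then show "sign_class (r (height ?D (j i - 1)) * r (Suc (height ?D (j i - 1)))) =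
       qsign q (int (j i) - (2 * int i - 1)) * qsign q (int (j i) - 2 * (int i - 1))"
      using h[OF i] by (subst sign_class_mult) (simp_all only: s r_nz zero_less_Suc not_False_eq_True)
  qed
  finally show ?thesis .
qed

lemma signature_sum:
  "(\<Sum>D\<in>two_row_paths n m. sign_class (path_norm q D n)) = (\<Sum>j\<in>ballot_seqs n m.
     \<Prod>i = 1..m. qsign q (int (j i) - (2 * int i - 1)) * qsign q (int (j i) - 2 * (int i - 1)))"
  unfolding sum.reindex_bij_betw[OF bij_betw_ballot_seqs, symmetric]
  by (intro sum.cong sign_class_path_norm refl)

end

theorem proposition4p3:
  fixes n m :: nat and q :: complex
  assumes "m \<le> n div 2"
    and "cmod q = 1"
    and "\<forall>k::nat. k > 0 \<longrightarrow> q ^ k \<noteq> 1"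
  shows "(\<exists>B. invariant_form n (specht (q\<^sup>2) [n - m, m]) (hecke_T (q\<^sup>2)) B) \<and>
    (\<forall>B. invariant_form n (specht (q\<^sup>2) [n - m, m]) (hecke_T (q\<^sup>2)) B \<longrightarrow>
      (\<exists>c::real. c \<noteq> 0 \<and>
        refined_signature (specht (q\<^sup>2) [n - m, m]) (\<lambda>u v. complex_of_real c * B u v) =
          (\<Sum>j \<in> {j \<in> {1..m} \<rightarrow>\<^sub>E {1..n}.
                    strict_mono_on {1..m} j \<and> (\<forall>i\<in>{1..m}. 2 * i \<le> j i)}.
            \<Prod>i = 1..m. qsign q (int (j i) - (2 * int i - 1)) * qsign q (int (j i) - 2 * (int i - 1)))))"
proof -
  interpret generic_unit q using assms(2,3) by unfold_locales auto
  have m: "2 * m \<le> n" using assms(1) by linarith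
  show ?thesis
    unfolding specht_eq_path_span[OF m]
    using invariant_exists[of n m] invariant_signature[OF _ m]
    unfolding signature_sum ballot_seqs_def by blast
qed

end
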